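(* Let $K$ be a field of characteristic zero and $n\geq 1$. Then $\mathrm{Aut}_{\mathrm{Lie}}(\mathfrak{div}_n^c)=G_n$; that is, the group homomorphism $G_n=\mathrm{Aut}_{K\text{-alg}}(P_n)\to \mathrm{Aut}_{\mathrm{Lie}}(\mathfrak{div}_n^c)$ sending $\sigma$ to the automorphism $\partial\mapsto\sigma\partial\sigma^{-1}$ is an isomorphism.
   Context: $P_n=K[x_1,\ldots,x_n]$ is the polynomial algebra, $G_n=\mathrm{Aut}_{K\text{-alg}}(P_n)$, $\partial_i=\partial/\partial x_i$, $D_n=\mathrm{Der}_K(P_n)=\bigoplus_{i=1}^n P_n\partial_i$ with bracket $[\partial,\delta]=\partial\delta-\delta\partial$. For $\partial=\sum_{i=1}^n a_i\partial_i\in D_n$, the divergence is $\mathrm{div}(\partial)=\sum_{i=1}^n \partial a_i/\partial x_i$. $\mathfrak{div}_n^c=\{\partial\in D_n : \mathrm{div}(\partial)\in K\}$ is the Lie algebra of derivations with constant divergence, a Lie subalgebra of $D_n$ stable under $\partial\mapsto\sigma\partial\sigma^{-1}$ for $\sigma\in G_n$. $\mathrm{Aut}_{\mathrm{Lie}}$ denotes the group of $K$-Lie algebra automorphisms. *)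

theory Defs
  imports "HOL-Algebra.Bij" "HOL-Library.Poly_Mapping"
begin

section \<open>The polynomial algebra\<close>

text \<open>
  Monomials in variables indexed by the finite type \<open>'n\<close> are exponent vectors, so
  \<open>('n, 'k) mpoly\<close> is $P_n = K[x_1,\ldots,x_n]$ with $n = $ \<open>CARD('n)\<close> $\geq 1$; its ring
  operations are those of the monoid algebra provided by \<^theory>\<open>HOL-Library.Poly_Mapping\<close>.
\<close>

type_synonym ('n, 'k) mpoly = "('n \<Rightarrow>\<^sub>0 nat) \<Rightarrow>\<^sub>0 'k"

definition Const :: "'k::field_char_0 \<Rightarrow> ('n, 'k) mpoly"
  where "Const c = Poly_Mapping.single 0 c"

definition Var :: "'n \<Rightarrow> ('n, 'k::field_char_0) mpoly"
  where "Var i = Poly_Mapping.single (Poly_Mapping.single i 1) 1"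

text \<open>For an exponent vector without \<open>i\<close> the truncated difference is harmless: the coefficient
  is then \<open>0\<close>.\<close>

definition partial :: "'n \<Rightarrow> ('n, 'k::field_char_0) mpoly \<Rightarrow> ('n, 'k) mpoly"
  where "partial i p =
    (\<Sum>m\<in>Poly_Mapping.keys p. Poly_Mapping.single (m - Poly_Mapping.single i 1)
       (of_nat (Poly_Mapping.lookup m i) * Poly_Mapping.lookup p m))"

section \<open>Derivations and divergence\<close>

definition derivations :: "(('n, 'k::field_char_0) mpoly \<Rightarrow> ('n, 'k) mpoly) set"
  where "derivations = {D.
    (\<forall>p q. D (p + q) = D p + D q) \<and>
    (\<forall>c p. D (Const c * p) = Const c * D p) \<and>
    (\<forall>p q. D (p * q) = D p * q + p * D q)}"

definition bracket ::
    "(('n, 'k::field_char_0) mpoly \<Rightarrow> ('n, 'k) mpoly) \<Rightarrow> (('n, 'k) mpoly \<Rightarrow> ('n, 'k) mpoly)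
      \<Rightarrow> ('n, 'k) mpoly \<Rightarrow> ('n, 'k) mpoly"
  where "bracket D E = (\<lambda>p. D (E p) - E (D p))"

text \<open>The coefficient of \<open>partial i\<close> in a derivation \<open>D\<close> is \<open>D (Var i)\<close>; see
  \<open>derivation_expansion\<close> and \<open>divergence_expansion\<close> below.\<close>

definition divergence :: "(('n::finite, 'k::field_char_0) mpoly \<Rightarrow> ('n, 'k) mpoly) \<Rightarrow> ('n, 'k) mpoly"
  where "divergence D = (\<Sum>i\<in>UNIV. partial i (D (Var i)))"

definition div_const :: "(('n::finite, 'k::field_char_0) mpoly \<Rightarrow> ('n, 'k) mpoly) set"
  where "div_const = {D \<in> derivations. \<exists>c. divergence D = Const c}"

section \<open>Automorphism groups\<close>

definition alg_auts :: "(('n, 'k::field_char_0) mpoly \<Rightarrow> ('n, 'k) mpoly) set"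
  where "alg_auts = {\<sigma>. bij \<sigma> \<and>
    (\<forall>p q. \<sigma> (p + q) = \<sigma> p + \<sigma> q) \<and>
    (\<forall>p q. \<sigma> (p * q) = \<sigma> p * \<sigma> q) \<and>
    (\<forall>c. \<sigma> (Const c) = Const c)}"

definition alg_aut_group :: "(('n, 'k::field_char_0) mpoly \<Rightarrow> ('n, 'k) mpoly) monoid"
  where "alg_aut_group = BijGroup UNIV \<lparr>carrier := alg_auts\<rparr>"

text \<open>\<open>L\<close> is meant to be a Lie subalgebra of \<^const>\<open>derivations\<close>. As for \<^const>\<open>BijGroup\<close>,
  automorphisms of \<open>L\<close> are taken to be extensional outside \<open>L\<close>.\<close>

definition lie_auts ::
    "(('n, 'k::field_char_0) mpoly \<Rightarrow> ('n, 'k) mpoly) set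
      \<Rightarrow> ((('n, 'k) mpoly \<Rightarrow> ('n, 'k) mpoly) \<Rightarrow> (('n, 'k) mpoly \<Rightarrow> ('n, 'k) mpoly)) set"
  where "lie_auts L = {\<phi> \<in> Bij L.
    (\<forall>D\<in>L. \<forall>E\<in>L. \<phi> (\<lambda>p. D p + E p) = (\<lambda>p. \<phi> D p + \<phi> E p)) \<and>
    (\<forall>c. \<forall>D\<in>L. \<phi> (\<lambda>p. Const c * D p) = (\<lambda>p. Const c * \<phi> D p)) \<and>
    (\<forall>D\<in>L. \<forall>E\<in>L. \<phi> (bracket D E) = bracket (\<phi> D) (\<phi> E))}"

definition lie_aut_group ::
    "(('n, 'k::field_char_0) mpoly \<Rightarrow> ('n, 'k) mpoly) set
      \<Rightarrow> ((('n, 'k) mpoly \<Rightarrow> ('n, 'k) mpoly) \<Rightarrow> (('n, 'k) mpoly \<Rightarrow> ('n, 'k) mpoly)) monoid"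
  where "lie_aut_group L = BijGroup L \<lparr>carrier := lie_auts L\<rparr>"

definition conjugation ::
    "(('n::finite, 'k::field_char_0) mpoly \<Rightarrow> ('n, 'k) mpoly)
      \<Rightarrow> (('n, 'k) mpoly \<Rightarrow> ('n, 'k) mpoly) \<Rightarrow> (('n, 'k) mpoly \<Rightarrow> ('n, 'k) mpoly)"
  where "conjugation \<sigma> = (\<lambda>D\<in>div_const. \<sigma> \<circ> D \<circ> inv_into UNIV \<sigma>)"

section \<open>Partial derivatives are derivations, and the expansion of a derivation\<close>

lemma lookup_partial:
  "Poly_Mapping.lookup (partial i p) m =
    of_nat (Poly_Mapping.lookup m i + 1) * Poly_Mapping.lookup p (m + Poly_Mapping.single i 1)"
proof -
  let ?s = "Poly_Mapping.single i (1::nat)"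
  have eq: "(of_nat (Poly_Mapping.lookup k i) * Poly_Mapping.lookup p k when k - ?s = m) =
     (if k = m + ?s then of_nat (Poly_Mapping.lookup m i + 1) * Poly_Mapping.lookup p (m + ?s) else 0)"
    for k
  proof (cases "Poly_Mapping.lookup k i = 0")
    case True
    then have "k \<noteq> m + ?s" by (auto simp: lookup_add)
    with True show ?thesis by simp
  next
    case False
    have "(k - ?s) + ?s = k"
      using False by (intro poly_mapping_eqI) (auto simp: lookup_add lookup_minus lookup_single when_def)
    then have "k - ?s = m \<longleftrightarrow> k = m + ?s" by auto
    then show ?thesis by (auto simp: lookup_add)
  qed
  have "Poly_Mapping.lookup (partial i p) m = (\<Sum>k\<in>Poly_Mapping.keys p.
      (of_nat (Poly_Mapping.lookup k i) * Poly_Mapping.lookup p k when k - ?s = m))"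
    by (simp add: partial_def lookup_sum lookup_single)
  also have "\<dots> = (\<Sum>k\<in>Poly_Mapping.keys p. if k = m + ?s
      then of_nat (Poly_Mapping.lookup m i + 1) * Poly_Mapping.lookup p (m + ?s) else 0)"
    by (simp only: eq)
  also have "\<dots> = of_nat (Poly_Mapping.lookup m i + 1) * Poly_Mapping.lookup p (m + ?s)"
    by (auto simp: sum.delta in_keys_iff)
  finally show ?thesis .
qed

lemma partial_add: "partial i (p + q) = partial i p + partial i q"
  by (intro poly_mapping_eqI) (simp only: lookup_partial lookup_add distrib_left)

lemma partial_zero [simp]: "partial i 0 = 0"
  by (simp add: partial_def)

lemma partial_diff: "partial i (p - q) = partial i p - partial i q"
  by (metis add_diff_cancel_right' diff_add_cancel partial_add)

lemma partial_sum: "partial i (sum f A) = (\<Sum>a\<in>A. partial i (f a))"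
  by (induction A rule: infinite_finite_induct) (auto simp: partial_add)

lemma partial_single:
  "partial i (Poly_Mapping.single m c) =
    Poly_Mapping.single (m - Poly_Mapping.single i 1) (of_nat (Poly_Mapping.lookup m i) * c)"
  by (cases "c = 0") (simp_all add: partial_def)

lemma mpoly_induct [case_names zero add]:
  assumes "P 0" and "\<And>p m c. P p \<Longrightarrow> P (p + Poly_Mapping.single m c)"
  shows "P (p :: ('n, 'k::field_char_0) mpoly)"
proof (induction p rule: update_induct)
  case (update f a b)
  then have "Poly_Mapping.update a b f = f + Poly_Mapping.single a b"
    by (intro poly_mapping_eqI) (auto simp: lookup_update lookup_add lookup_single in_keys_iff when_def)
  with update assms(2) show ?case by simp
qed (fact assms(1))

lemma partial_mult_single:
  "partial i (Poly_Mapping.single a c * Poly_Mapping.single b d) =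
    partial i (Poly_Mapping.single a c) * Poly_Mapping.single b d +
    Poly_Mapping.single a c * partial i (Poly_Mapping.single b d)"
proof -
  let ?s = "Poly_Mapping.single i (1::nat)"
  have l: "Poly_Mapping.single (a + b - ?s) (of_nat (Poly_Mapping.lookup a i) * c * d) =
      Poly_Mapping.single (a - ?s + b) (of_nat (Poly_Mapping.lookup a i) * c * d)"
  proof (cases "Poly_Mapping.lookup a i = 0")
    case False
    then have "a + b - ?s = a - ?s + b"
      by (intro poly_mapping_eqI) (auto simp: lookup_add lookup_minus lookup_single when_def)
    then show ?thesis by simp
  qed simp
  have r: "Poly_Mapping.single (a + b - ?s) (of_nat (Poly_Mapping.lookup b i) * c * d) =
      Poly_Mapping.single (a + (b - ?s)) (of_nat (Poly_Mapping.lookup b i) * c * d)"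
  proof (cases "Poly_Mapping.lookup b i = 0")
    case False
    then have "a + b - ?s = a + (b - ?s)"
      by (intro poly_mapping_eqI) (auto simp: lookup_add lookup_minus lookup_single when_def)
    then show ?thesis by simp
  qed simp
  have "partial i (Poly_Mapping.single a c * Poly_Mapping.single b d) =
     Poly_Mapping.single (a + b - ?s) (of_nat (Poly_Mapping.lookup a i) * c * d) +
     Poly_Mapping.single (a + b - ?s) (of_nat (Poly_Mapping.lookup b i) * c * d)"
    by (simp add: mult_single partial_single lookup_add single_add [symmetric] algebra_simps)
  also have "\<dots> = partial i (Poly_Mapping.single a c) * Poly_Mapping.single b d +
    Poly_Mapping.single a c * partial i (Poly_Mapping.single b d)"
    unfolding l r by (simp add: mult_single partial_single mult_ac add.commute)
  finally show ?thesis .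
qed

lemma partial_mult: "partial i (p * q) = partial i p * q + p * partial i q"
proof (induction p rule: mpoly_induct)
  case (add p m c)
  have "partial i (Poly_Mapping.single m c * q) =
      partial i (Poly_Mapping.single m c) * q + Poly_Mapping.single m c * partial i q"
  proof (induction q rule: mpoly_induct)
    case (add q b d)
    then show ?case by (simp add: distrib_left partial_add partial_mult_single add_ac)
  qed simp
  with add show ?case by (simp add: distrib_right partial_add add_ac)
qed simp

lemma partial_Const [simp]: "partial i (Const c) = 0"
  by (simp add: Const_def partial_single)

lemma partial_Var: "partial i (Var j) = (if i = j then 1 else 0)"
  by (simp add: Var_def partial_single lookup_single flip: single_one)

lemma partial_commute: "partial i (partial j p) = partial j (partial i p)"
  by (intro poly_mapping_eqI)
    (cases "i = j", simp_all add: lookup_partial lookup_add lookup_single add_ac mult_ac)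

lemma partial_derivation: "partial i \<in> derivations"
  by (simp add: derivations_def partial_add partial_mult)

lemma Const_0 [simp]: "Const 0 = 0" and Const_1 [simp]: "Const 1 = 1"
  and Const_add: "Const (c + d) = Const c + Const d"
  and Const_mult: "Const (c * d) = Const c * Const d"
  by (simp_all add: Const_def single_add mult_single)

lemma derivationI:
  assumes "\<And>p q. D (p + q) = D p + D q" "\<And>c p. D (Const c * p) = Const c * D p"
    and "\<And>p q. D (p * q) = D p * q + p * D q"
  shows "D \<in> derivations"
  using assms unfolding derivations_def by blast

lemma derivationD:
  assumes "D \<in> derivations"
  shows "D (p + q) = D p + D q" "D (p * q) = D p * q + p * D q" "D (Const c * p) = Const c * D p"
    "D 0 = 0" "D (Const c) = 0" "D 1 = 0" "D (p - q) = D p - D q"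
    "D (sum f A) = (\<Sum>a\<in>A. D (f a))"
proof -
  show a: "D (p + q) = D p + D q" for p q using assms by (simp add: derivations_def)
  show m: "D (p * q) = D p * q + p * D q" for p q using assms by (simp add: derivations_def)
  show s: "D (Const c * p) = Const c * D p" for c p using assms unfolding derivations_def by blast
  show z: "D 0 = 0" using a [of 0 0] by simp
  show o: "D 1 = 0" using m [of 1 1] by simp
  show "D (Const c) = 0" for c using s [of c 1] o by simp
  show "D (p - q) = D p - D q" by (metis a add_diff_cancel_right' diff_add_cancel)
  show "D (sum f A) = (\<Sum>a\<in>A. D (f a))"
    by (induction A rule: infinite_finite_induct) (auto simp: a z)
qed

lemma combination_derivation:
  fixes a :: "'n::finite \<Rightarrow> ('n, 'k::field_char_0) mpoly"
  shows "(\<lambda>p. \<Sum>i\<in>UNIV. a i * partial i p) \<in> derivations"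
  by (simp add: derivations_def partial_add partial_mult distrib_left sum.distrib sum_distrib_left
      sum_distrib_right mult_ac)

lemma derivations_eqI:
  fixes D E :: "('n, 'k::field_char_0) mpoly \<Rightarrow> ('n, 'k) mpoly"
  assumes D: "D \<in> derivations" and E: "E \<in> derivations" and v: "\<And>i. D (Var i) = E (Var i)"
  shows "D = E"
proof
  have mon: "D (Poly_Mapping.single m 1) = E (Poly_Mapping.single m 1)" for m
  proof (induction m rule: update_induct)
    case const
    show ?case by (simp add: derivationD(6) [OF D] derivationD(6) [OF E])
  next
    case (update f a b)
    have pow: "D (Poly_Mapping.single (Poly_Mapping.single a b) 1) =
        E (Poly_Mapping.single (Poly_Mapping.single a b) 1)" for b :: nat
    proof (induction b)
      case 0
      show ?case by (simp add: derivationD(6) [OF D] derivationD(6) [OF E])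
    next
      case (Suc b)
      have "Poly_Mapping.single (Poly_Mapping.single a (Suc b)) 1 =
          Var a * Poly_Mapping.single (Poly_Mapping.single a b) (1::'k)"
        by (simp add: Var_def mult_single flip: single_add)
      with Suc show ?case by (simp add: derivationD(2) [OF D] derivationD(2) [OF E] v)
    qed
    have "Poly_Mapping.update a b f = f + Poly_Mapping.single a b"
      using update
      by (intro poly_mapping_eqI) (auto simp: lookup_update lookup_add lookup_single in_keys_iff when_def)
    then have "Poly_Mapping.single (Poly_Mapping.update a b f) (1::'k) =
        Poly_Mapping.single f 1 * Poly_Mapping.single (Poly_Mapping.single a b) 1"
      by (simp add: mult_single)
    then show ?case
      by (simp add: derivationD(2) [OF D] derivationD(2) [OF E] pow update)
  qed
  fix p
  show "D p = E p"
  proof (induction p rule: mpoly_induct)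
    case zero
    show ?case by (simp add: derivationD(4) [OF D] derivationD(4) [OF E])
  next
    case (add p m c)
    have "Poly_Mapping.single m c = Const c * Poly_Mapping.single m 1"
      by (simp add: Const_def mult_single)
    with add mon show ?case
      by (simp add: derivationD(1,3) [OF D] derivationD(1,3) [OF E])
  qed
qed

lemma combination_Var:
  fixes a :: "'n::finite \<Rightarrow> ('n, 'k::field_char_0) mpoly"
  shows "(\<Sum>i\<in>UNIV. a i * partial i (Var j)) = a j"
proof -
  have "(\<Sum>i\<in>UNIV. a i * partial i (Var j)) = (\<Sum>i\<in>UNIV. if i = j then a i else 0)"
    by (intro sum.cong) (auto simp: partial_Var)
  then show ?thesis by simp
qed

theorem derivation_expansion:
  fixes D :: "('n::finite, 'k::field_char_0) mpoly \<Rightarrow> ('n, 'k) mpoly"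
  assumes "D \<in> derivations"
  shows "D = (\<lambda>p. \<Sum>i\<in>UNIV. D (Var i) * partial i p)"
  by (intro derivations_eqI assms combination_derivation) (simp add: combination_Var)

theorem divergence_expansion:
  fixes a :: "'n::finite \<Rightarrow> ('n, 'k::field_char_0) mpoly"
  shows "divergence (\<lambda>p. \<Sum>i\<in>UNIV. a i * partial i p) = (\<Sum>i\<in>UNIV. partial i (a i))"
  by (simp add: divergence_def combination_Var)

section \<open>Derivations of constant divergence form a Lie algebra\<close>

lemma derivations_add: "D \<in> derivations \<Longrightarrow> E \<in> derivations \<Longrightarrow> (\<lambda>p. D p + E p) \<in> derivations"
  by (rule derivationI) (simp_all add: derivationD(1) derivationD(3) derivationD(2) [where D=D]
      derivationD(2) [where D=E] derivationD(5) distrib_left distrib_right add_ac)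

lemma derivations_scale: "D \<in> derivations \<Longrightarrow> (\<lambda>p. Const c * D p) \<in> derivations"
  by (rule derivationI) (simp_all add: derivationD(1) derivationD(3) derivationD(2) [where D=D]
      derivationD(5) distrib_left mult_ac)

lemma derivations_bracket:
  assumes D: "D \<in> derivations" and E: "E \<in> derivations"
  shows "bracket D E \<in> derivations"
proof (rule derivationI)
  fix p q c
  show "bracket D E (p + q) = bracket D E p + bracket D E q"
    by (simp add: bracket_def derivationD(1) [OF D] derivationD(1) [OF E])
  show "bracket D E (Const c * p) = Const c * bracket D E p"
    by (simp add: bracket_def derivationD(3) [OF D] derivationD(3) [OF E] right_diff_distrib)
  show "bracket D E (p * q) = bracket D E p * q + p * bracket D E q"
    by (simp add: bracket_def derivationD(1,2) [OF D] derivationD(1,2) [OF E] algebra_simps)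
qed

lemma partial_derivation_apply:
  fixes D :: "('n::finite, 'k::field_char_0) mpoly \<Rightarrow> ('n, 'k) mpoly"
  assumes "D \<in> derivations"
  shows "partial i (D p) = D (partial i p) + (\<Sum>j\<in>UNIV. partial i (D (Var j)) * partial j p)"
proof -
  have "partial i (D p) = partial i (\<Sum>j\<in>UNIV. D (Var j) * partial j p)"
    using derivation_expansion [OF assms] by metis
  also have "\<dots> = (\<Sum>j\<in>UNIV. D (Var j) * partial j (partial i p)) +
      (\<Sum>j\<in>UNIV. partial i (D (Var j)) * partial j p)"
    by (simp add: partial_sum partial_mult sum.distrib add_ac partial_commute [of i])
  also have "(\<Sum>j\<in>UNIV. D (Var j) * partial j (partial i p)) = D (partial i p)"
    using derivation_expansion [OF assms] by metis
  finally show ?thesis .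
qed

theorem divergence_bracket:
  fixes D E :: "('n::finite, 'k::field_char_0) mpoly \<Rightarrow> ('n, 'k) mpoly"
  assumes D: "D \<in> derivations" and E: "E \<in> derivations"
  shows "divergence (bracket D E) = D (divergence E) - E (divergence D)"
proof -
  have "divergence (bracket D E) =
      (\<Sum>i\<in>UNIV. D (partial i (E (Var i)))) +
      (\<Sum>i\<in>UNIV. \<Sum>j\<in>UNIV. partial i (D (Var j)) * partial j (E (Var i))) -
      ((\<Sum>i\<in>UNIV. E (partial i (D (Var i)))) +
      (\<Sum>i\<in>UNIV. \<Sum>j\<in>UNIV. partial i (E (Var j)) * partial j (D (Var i))))"
    by (simp add: divergence_def bracket_def partial_diff partial_derivation_apply [OF D, of _ "E (Var _)"]
        partial_derivation_apply [OF E, of _ "D (Var _)"] sum_subtractf sum.distrib)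
  moreover have "(\<Sum>i\<in>UNIV. \<Sum>j\<in>UNIV. partial i (D (Var j)) * partial j (E (Var i))) =
      (\<Sum>i\<in>UNIV. \<Sum>j\<in>UNIV. partial i (E (Var j)) * partial j (D (Var i)))"
    by (subst sum.swap) (simp add: mult.commute)
  ultimately show ?thesis
    by (simp add: divergence_def derivationD(8) [OF D] derivationD(8) [OF E])
qed

theorem div_const_add:
  assumes D: "D \<in> div_const" and E: "E \<in> div_const"
  shows "(\<lambda>p. D p + E p) \<in> div_const"
proof -
  obtain d e where "divergence D = Const d" "divergence E = Const e"
    using D E by (auto simp: div_const_def)
  then have "divergence (\<lambda>p. D p + E p) = Const (d + e)"
    by (simp add: divergence_def partial_add sum.distrib Const_add)
  then show ?thesis using D E derivations_add [of D E] by (auto simp: div_const_def)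
qed

theorem div_const_scale:
  assumes D: "D \<in> div_const"
  shows "(\<lambda>p. Const c * D p) \<in> div_const"
proof -
  obtain d where "divergence D = Const d"
    using D by (auto simp: div_const_def)
  then have "divergence (\<lambda>p. Const c * D p) = Const (c * d)"
    by (simp add: divergence_def partial_mult Const_mult flip: sum_distrib_left)
  then show ?thesis using D derivations_scale [of D c] by (auto simp: div_const_def)
qed

theorem div_const_bracket:
  assumes D: "D \<in> div_const" and E: "E \<in> div_const"
  shows "bracket D E \<in> div_const"
proof -
  obtain d e where d: "divergence D = Const d" and e: "divergence E = Const e"
    using D E by (auto simp: div_const_def)
  have D': "D \<in> derivations" and E': "E \<in> derivations" using D E by (auto simp: div_const_def)
  have "divergence (bracket D E) = Const 0"
    using d e by (simp add: divergence_bracket [OF D' E'] derivationD(5) [OF D'] derivationD(5) [OF E'])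
  then show ?thesis
    using derivations_bracket [OF D' E'] unfolding div_const_def by blast
qed

section \<open>The automorphism groups are groups\<close>

theorem group_alg_aut_group: "group (alg_aut_group :: (('n, 'k::field_char_0) mpoly \<Rightarrow> _) monoid)"
proof -
  have "subgroup alg_auts (BijGroup (UNIV :: ('n, 'k) mpoly set))"
  proof (rule group.subgroupI [OF group_BijGroup])
    show "alg_auts \<subseteq> carrier (BijGroup (UNIV :: ('n, 'k) mpoly set))"
      by (auto simp: alg_auts_def BijGroup_def Bij_def)
    have "id \<in> (alg_auts :: (('n, 'k) mpoly \<Rightarrow> _) set)" by (simp add: alg_auts_def)
    then show "(alg_auts :: (('n, 'k) mpoly \<Rightarrow> _) set) \<noteq> {}" by blast
  next
    fix f :: "('n, 'k) mpoly \<Rightarrow> ('n, 'k) mpoly"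
    assume f: "f \<in> alg_auts"
    then have b: "bij f" by (simp add: alg_auts_def)
    have i: "inv_into UNIV f (f x) = x" "f (inv_into UNIV f x) = x" for x
      using b by (simp_all add: bij_is_inj bij_is_surj surj_f_inv_f)
    have "m_inv (BijGroup UNIV) f = inv_into UNIV f"
      using b by (subst inv_BijGroup) (auto simp: Bij_def restrict_def)
    moreover have "inv_into UNIV f \<in> alg_auts"
      unfolding alg_auts_def
    proof (intro CollectI conjI allI)
      show "bij (inv_into UNIV f)" by (rule bij_imp_bij_inv [OF b])
    next
      fix p q
      have "inv_into UNIV f (f (inv_into UNIV f p) + f (inv_into UNIV f q)) =
          inv_into UNIV f p + inv_into UNIV f q"
        using f by (metis (mono_tags, lifting) alg_auts_def i(1) mem_Collect_eq)
      then show "inv_into UNIV f (p + q) = inv_into UNIV f p + inv_into UNIV f q" by (simp add: i)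
      have "inv_into UNIV f (f (inv_into UNIV f p) * f (inv_into UNIV f q)) =
          inv_into UNIV f p * inv_into UNIV f q"
        using f by (metis (mono_tags, lifting) alg_auts_def i(1) mem_Collect_eq)
      then show "inv_into UNIV f (p * q) = inv_into UNIV f p * inv_into UNIV f q" by (simp add: i)
    next
      fix c
      show "inv_into UNIV f (Const c) = Const c"
        using f by (metis (mono_tags, lifting) alg_auts_def i(1) mem_Collect_eq)
    qed
    ultimately show "m_inv (BijGroup UNIV) f \<in> alg_auts" by simp
  next
    fix f g :: "('n, 'k) mpoly \<Rightarrow> ('n, 'k) mpoly"
    assume "f \<in> alg_auts" "g \<in> alg_auts"
    then show "f \<otimes>\<^bsub>BijGroup UNIV\<^esub> g \<in> alg_auts"
      by (auto simp: alg_auts_def BijGroup_def Bij_def compose_def intro: bij_comp [unfolded o_def])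
  qed
  then show ?thesis
    unfolding alg_aut_group_def by (rule subgroup.subgroup_is_group [OF _ group_BijGroup])
qed

lemma lie_autsI:
  assumes "\<phi> \<in> Bij L"
    and "\<And>D E. D \<in> L \<Longrightarrow> E \<in> L \<Longrightarrow> \<phi> (\<lambda>p. D p + E p) = (\<lambda>p. \<phi> D p + \<phi> E p)"
    and "\<And>c D. D \<in> L \<Longrightarrow> \<phi> (\<lambda>p. Const c * D p) = (\<lambda>p. Const c * \<phi> D p)"
    and "\<And>D E. D \<in> L \<Longrightarrow> E \<in> L \<Longrightarrow> \<phi> (bracket D E) = bracket (\<phi> D) (\<phi> E)"
  shows "\<phi> \<in> lie_auts L"
  unfolding lie_auts_def using assms by blast

lemma lie_autsD:
  assumes "\<phi> \<in> lie_auts L"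
  shows "\<phi> \<in> Bij L" "D \<in> L \<Longrightarrow> \<phi> D \<in> L"
    and "D \<in> L \<Longrightarrow> E \<in> L \<Longrightarrow> \<phi> (\<lambda>p. D p + E p) = (\<lambda>p. \<phi> D p + \<phi> E p)"
    and "D \<in> L \<Longrightarrow> \<phi> (\<lambda>p. Const c * D p) = (\<lambda>p. Const c * \<phi> D p)"
    and "D \<in> L \<Longrightarrow> E \<in> L \<Longrightarrow> \<phi> (bracket D E) = bracket (\<phi> D) (\<phi> E)"
proof -
  show b: "\<phi> \<in> Bij L" using assms unfolding lie_auts_def by blast
  show "D \<in> L \<Longrightarrow> \<phi> D \<in> L" using Bij_imp_funcset [OF b] by blast
qed (use assms in \<open>unfold lie_auts_def, blast\<close>)+

theorem group_lie_aut_group: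
  assumes add: "\<And>D E. D \<in> L \<Longrightarrow> E \<in> L \<Longrightarrow> (\<lambda>p. D p + E p) \<in> L"
    and scale: "\<And>c D. D \<in> L \<Longrightarrow> (\<lambda>p. Const c * D p) \<in> L"
    and brk: "\<And>D E. D \<in> L \<Longrightarrow> E \<in> L \<Longrightarrow> bracket D E \<in> L"
  shows "group (lie_aut_group L)"
proof -
  have "subgroup (lie_auts L) (BijGroup L)"
  proof (rule group.subgroupI [OF group_BijGroup])
    show "lie_auts L \<subseteq> carrier (BijGroup L)" by (auto simp: lie_auts_def BijGroup_def)
    have "(\<lambda>D\<in>L. D) \<in> lie_auts L"
    proof (rule lie_autsI)
      show "(\<lambda>D\<in>L. D) \<in> Bij L" by (rule id_Bij)
    next
      fix D E assume D: "D \<in> L" and E: "E \<in> L"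
      show "(\<lambda>D\<in>L. D) (\<lambda>p. D p + E p) = (\<lambda>p. (\<lambda>D\<in>L. D) D p + (\<lambda>D\<in>L. D) E p)"
        unfolding restrict_apply' [OF D] restrict_apply' [OF E] restrict_apply' [OF add [OF D E]] ..
      show "(\<lambda>D\<in>L. D) (bracket D E) = bracket ((\<lambda>D\<in>L. D) D) ((\<lambda>D\<in>L. D) E)"
        unfolding restrict_apply' [OF D] restrict_apply' [OF E] restrict_apply' [OF brk [OF D E]] ..
    next
      fix c D assume D: "D \<in> L"
      show "(\<lambda>D\<in>L. D) (\<lambda>p. Const c * D p) = (\<lambda>p. Const c * (\<lambda>D\<in>L. D) D p)"
        unfolding restrict_apply' [OF D] restrict_apply' [OF scale [OF D]] ..
    qed
    then show "lie_auts L \<noteq> {}" by blast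
  next
    fix f assume f: "f \<in> lie_auts L"
    note b = lie_autsD(1) [OF f]
    let ?g = "inv_into L f"
    have g: "?g D \<in> L" if "D \<in> L" for D using b that by (rule Bij_inv_into_mem)
    have fg: "f (?g D) = D" if "D \<in> L" for D
      using b that bij_betw_inv_into_right [of f L L D] by (simp add: Bij_def)
    have gf: "?g (f D) = D" if "D \<in> L" for D
      using b that bij_betw_inv_into_left [of f L L D] by (simp add: Bij_def)
    have "restrict ?g L \<in> lie_auts L"
    proof (rule lie_autsI)
      show "restrict ?g L \<in> Bij L" by (rule restrict_inv_into_Bij [OF b])
    next
      fix D E assume D: "D \<in> L" and E: "E \<in> L"
      note r = restrict_apply' [OF D] restrict_apply' [OF E]
      have "f (\<lambda>p. ?g D p + ?g E p) = (\<lambda>p. D p + E p)"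
        using lie_autsD(3) [OF f g [OF D] g [OF E]] unfolding fg [OF D] fg [OF E] .
      from arg_cong [OF this, of ?g]
      show "restrict ?g L (\<lambda>p. D p + E p) = (\<lambda>p. restrict ?g L D p + restrict ?g L E p)"
        unfolding r restrict_apply' [OF add [OF D E]] gf [OF add [OF g [OF D] g [OF E]]] by (rule sym)
      have "f (bracket (?g D) (?g E)) = bracket D E"
        using lie_autsD(5) [OF f g [OF D] g [OF E]] unfolding fg [OF D] fg [OF E] .
      from arg_cong [OF this, of ?g]
      show "restrict ?g L (bracket D E) = bracket (restrict ?g L D) (restrict ?g L E)"
        unfolding r restrict_apply' [OF brk [OF D E]] gf [OF brk [OF g [OF D] g [OF E]]] by (rule sym)
    next
      fix c D assume D: "D \<in> L"
      have "f (\<lambda>p. Const c * ?g D p) = (\<lambda>p. Const c * D p)"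
        using lie_autsD(4) [OF f g [OF D], of c] unfolding fg [OF D] .
      from arg_cong [OF this, of ?g]
      show "restrict ?g L (\<lambda>p. Const c * D p) = (\<lambda>p. Const c * restrict ?g L D p)"
        unfolding restrict_apply' [OF D] restrict_apply' [OF scale [OF D]] gf [OF scale [OF g [OF D]]]
        by (rule sym)
    qed
    then show "m_inv (BijGroup L) f \<in> lie_auts L"
      by (simp only: inv_BijGroup [OF b])
  next
    fix f g assume f: "f \<in> lie_auts L" and g: "g \<in> lie_auts L"
    note fD = lie_autsD [OF f] and gD = lie_autsD [OF g]
    have "compose L f g \<in> lie_auts L"
    proof (rule lie_autsI)
      show "compose L f g \<in> Bij L" by (rule compose_Bij [OF fD(1) gD(1)])
    next
      fix D E assume D: "D \<in> L" and E: "E \<in> L"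
      note r = compose_eq [OF D] compose_eq [OF E]
      show "compose L f g (\<lambda>p. D p + E p) = (\<lambda>p. compose L f g D p + compose L f g E p)"
        unfolding r compose_eq [OF add [OF D E]] gD(3) [OF D E]
        by (rule fD(3) [OF gD(2) [OF D] gD(2) [OF E]])
      show "compose L f g (bracket D E) = bracket (compose L f g D) (compose L f g E)"
        unfolding r compose_eq [OF brk [OF D E]] gD(5) [OF D E]
        by (rule fD(5) [OF gD(2) [OF D] gD(2) [OF E]])
    next
      fix c D assume D: "D \<in> L"
      show "compose L f g (\<lambda>p. Const c * D p) = (\<lambda>p. Const c * compose L f g D p)"
        unfolding compose_eq [OF D] compose_eq [OF scale [OF D]] gD(4) [OF D]
        by (rule fD(4) [OF gD(2) [OF D]])
    qed
    then show "f \<otimes>\<^bsub>BijGroup L\<^esub> g \<in> lie_auts L"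
      using fD(1) gD(1) by (simp add: BijGroup_def)
  qed
  then show ?thesis
    unfolding lie_aut_group_def by (rule subgroup.subgroup_is_group [OF _ group_BijGroup])
qed

corollary group_lie_aut_div_const:
  "group (lie_aut_group (div_const :: (('n::finite, 'k::field_char_0) mpoly \<Rightarrow> _) set))"
proof (rule group_lie_aut_group)
  fix D E :: "('n, 'k) mpoly \<Rightarrow> ('n, 'k) mpoly" and c :: 'k
  assume D: "D \<in> div_const"
  show "(\<lambda>p. Const c * D p) \<in> div_const" by (rule div_const_scale [OF D])
  assume E: "E \<in> div_const"
  show "(\<lambda>p. D p + E p) \<in> div_const" by (rule div_const_add [OF D E])
  show "bracket D E \<in> div_const" by (rule div_const_bracket [OF D E])
qed

end

theory Submission
  imports Defs "HOL-Analysis.Determinants"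
begin

text \<open>
  Let \<open>\<phi>\<close> be an automorphism of the Lie algebra and \<open>\<delta>\<^sub>i = \<phi>(\<partial>\<^sub>i)\<close>. For fields \<open>E\<^sub>1, \<dots>, E\<^sub>n\<close> put
  \<open>F(E) = det (E\<^sub>i(x\<^sub>j))\<close>; the Lie derivative formula is
  \<open>X(F(E)) - div(X) F(E) = \<Sum>\<^sub>k F(E\<^sub>1, \<dots>, [X, E\<^sub>k], \<dots>, E\<^sub>n)\<close>. Since \<open>ad \<delta>\<^sub>i\<close> is locally nilpotent on the
  Lie algebra, \<open>\<delta>\<^sub>i - div(\<delta>\<^sub>i)\<close> is nilpotent on every \<open>F(E)\<close>. The values \<open>1\<close> and \<open>x\<^sub>j\<close> of \<open>F\<close> show that
  \<open>div(\<delta>\<^sub>i) = 0\<close> and that \<open>\<delta>\<^sub>i\<close> is locally nilpotent on \<open>P\<^sub>n\<close>. The joint kernel of the \<open>\<delta>\<^sub>i\<close> is \<open>K\<close>, and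
  they form a \<open>P\<^sub>n\<close>-basis of all derivations. Expanding \<open>\<phi>(\<Sum> x\<^sub>k \<partial>\<^sub>k) = \<Sum> y\<^sub>k \<delta>\<^sub>k\<close> gives \<open>\<delta>\<^sub>i(y\<^sub>k) = 1\<close> for \<open>i = k\<close>
  and \<open>0\<close> otherwise, so \<open>\<sigma>: x\<^sub>k \<mapsto> y\<^sub>k\<close> is an algebra automorphism with \<open>\<sigma> \<partial>\<^sub>i \<sigma>\<^sup>-\<^sup>1 = \<delta>\<^sub>i\<close>. Finally \<open>\<phi>\<close> and
  conjugation by \<open>\<sigma>\<close> agree on the \<open>\<partial>\<^sub>i\<close> and on the Euler field, and by induction on the degree
  everywhere.
\<close>

section \<open>Polynomials\<close>

lemma Const_eq_iff [simp]: "Const c = Const d \<longleftrightarrow> c = d"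
  unfolding Const_def by (metis lookup_single_eq)

lemma Const_eq_0_iff [simp]: "Const c = 0 \<longleftrightarrow> c = 0"
  by (metis Const_0 Const_eq_iff)

lemma lookup_Const: "Poly_Mapping.lookup (Const c) m = (if m = 0 then c else 0)"
  by (simp add: Const_def lookup_single when_def)

lemma lookup_Const_mult: "Poly_Mapping.lookup (Const c * p) m = c * Poly_Mapping.lookup p m"
proof (induction p rule: mpoly_induct)
  case (add p k d)
  then show ?case
    by (simp add: distrib_left lookup_add Const_def mult_single lookup_single when_def)
qed simp

lemma of_nat_mpoly: "(of_nat a :: ('n, 'k::field_char_0) mpoly) = Const (of_nat a)"
  by (induction a) (simp_all add: Const_add)

lemma Const_minus: "Const (- c) = - Const c"
  by (metis Const_0 Const_add add.right_inverse add_eq_0_iff)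

text \<open>A monomial \<open>m\<close> other than 1 has a positive exponent at some
  \<open>i\<close>. Its coefficient, times that exponent, is a coefficient of
  \<open>partial i p\<close>, and in characteristic zero the factor cancels.\<close>

lemma partials_zero_imp_Const:
  assumes "\<And>i. partial i p = 0"
  shows "p = Const (Poly_Mapping.lookup p 0)"
proof (rule poly_mapping_eqI)
  fix m
  show "Poly_Mapping.lookup p m = Poly_Mapping.lookup (Const (Poly_Mapping.lookup p 0)) m"
  proof (cases "m = 0")
    case False
    then obtain i where i: "Poly_Mapping.lookup m i \<noteq> 0"
      by (metis lookup_zero poly_mapping_eqI)
    let ?k = "m - Poly_Mapping.single i 1"
    have "?k + Poly_Mapping.single i 1 = m"
      using i by (intro poly_mapping_eqI) (auto simp: lookup_add lookup_minus lookup_single when_def)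
    then have "Poly_Mapping.lookup (partial i p) ?k =
        of_nat (Suc (Poly_Mapping.lookup ?k i)) * Poly_Mapping.lookup p m"
      by (simp add: lookup_partial)
    with assms have "Poly_Mapping.lookup p m = 0" by (simp del: of_nat_Suc)
    with False show ?thesis by (simp add: lookup_Const)
  qed (simp add: lookup_Const)
qed

lemma Const_of_partials_zero:
  assumes "\<And>i. partial i p = 0"
  obtains c where "p = Const c"
  using partials_zero_imp_Const [OF assms] that by blast

section \<open>Degree bounds and local nilpotency of the partial derivatives\<close>

definition mdegree :: "('n::finite \<Rightarrow>\<^sub>0 nat) \<Rightarrow> nat"
  where "mdegree m = (\<Sum>i\<in>UNIV. Poly_Mapping.lookup m i)"

lemma mdegree_add_single [simp]: "mdegree (m + Poly_Mapping.single i a) = mdegree m + a"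
  by (simp add: mdegree_def lookup_add sum.distrib lookup_single when_def)

lemma mdegree_0 [simp]: "mdegree 0 = 0"
  by (simp add: mdegree_def)

lemma mdegree_eq_0_iff [simp]: "mdegree m = 0 \<longleftrightarrow> m = 0"
  by (auto simp: mdegree_def intro: poly_mapping_eqI)

text \<open>The bound is strict so that \<open>below 0\<close> singles out the zero polynomial and
  no degree has to be assigned to it; \<open>below 1\<close> then means constant.\<close>

definition below :: "nat \<Rightarrow> ('n::finite, 'k::field_char_0) mpoly \<Rightarrow> bool"
  where "below N p \<longleftrightarrow> (\<forall>m. Poly_Mapping.lookup p m \<noteq> 0 \<longrightarrow> mdegree m < N)"

lemma below_partial: "below N p \<Longrightarrow> below (N - 1) (partial i p)"
  unfolding below_def lookup_partial
  by (metis (no_types) One_nat_def mdegree_add_single less_diff_conv mult_zero_right)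

lemma below_0_iff [simp]: "below 0 p \<longleftrightarrow> p = 0"
  by (auto simp: below_def intro: poly_mapping_eqI)

lemma below_mono: "below M p \<Longrightarrow> M \<le> N \<Longrightarrow> below N p"
  unfolding below_def by (meson less_le_trans)

lemma ex_below: "\<exists>N. below N p"
proof -
  have "finite (mdegree ` Poly_Mapping.keys p)" by simp
  then obtain N where "\<forall>d\<in>mdegree ` Poly_Mapping.keys p. d < N"
    by (metis finite_nat_set_iff_bounded)
  then show ?thesis unfolding below_def by (intro exI [of _ N]) (auto simp: in_keys_iff)
qed

lemma partial_funpow_below: "below N p \<Longrightarrow> (partial i ^^ N) p = 0"
proof (induction N arbitrary: p)
  case (Suc N)
  from below_partial [OF Suc.prems, of i] Suc.IH show ?case
    by (simp add: funpow_swap1)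
qed simp

lemma partial_locally_nilpotent: "\<exists>N. (partial i ^^ N) p = 0"
  for p :: "('n::finite, 'k::field_char_0) mpoly"
  using ex_below partial_funpow_below by blast

lemma funpow_fixed_point: "f z = z \<Longrightarrow> (f ^^ N) z = z"
  by (induction N) auto

text \<open>The operators are treated one at a time. The last iterate of \<open>T i\<close> on
  \<open>w\<close> different from \<open>z\<close> is sent to \<open>z\<close> by
  \<open>T i\<close>, and by commutation still by all earlier operators. Only the fixed point
  \<open>z\<close> matters and not linearity, so the lemma serves polynomials and families of
  coefficients alike.\<close>

lemma joint_kernel_nontrivial:
  fixes T :: "'i \<Rightarrow> 'v \<Rightarrow> 'v"
  assumes "finite S"
    and stable: "\<And>i v. i \<in> S \<Longrightarrow> v \<in> R \<Longrightarrow> T i v \<in> R"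
    and zero: "\<And>i. i \<in> S \<Longrightarrow> T i z = z"
    and comm: "\<And>i j v. i \<in> S \<Longrightarrow> j \<in> S \<Longrightarrow> v \<in> R \<Longrightarrow> T i (T j v) = T j (T i v)"
    and nil: "\<And>i v. i \<in> S \<Longrightarrow> v \<in> R \<Longrightarrow> \<exists>N. (T i ^^ N) v = z"
    and v: "v \<in> R" "v \<noteq> z"
  shows "\<exists>w\<in>R. w \<noteq> z \<and> (\<forall>i\<in>S. T i w = z)"
  using assms(1) order_refl
proof (induction rule: finite_subset_induct')
  case (insert i F)
  then obtain w where w: "w \<in> R" "w \<noteq> z" "\<forall>j\<in>F. T j w = z" by blast
  define N where "N = (LEAST N. (T i ^^ N) w = z)"
  have N: "(T i ^^ N) w = z" unfolding N_def by (rule LeastI_ex) (rule nil [OF \<open>i \<in> S\<close> w(1)])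
  with w obtain M where M: "N = Suc M" by (cases N) auto
  have R: "(T i ^^ K) w \<in> R" for K by (induction K) (use w insert stable in auto)
  have "T j ((T i ^^ K) w) = (T i ^^ K) (T j w)" if "j \<in> S" for j K
    by (induction K) (use that R insert comm in auto)
  then have "T j ((T i ^^ M) w) = z" if "j \<in> F" for j
    using that w insert zero by (simp add: subset_iff funpow_fixed_point)
  moreover have "(T i ^^ M) w \<noteq> z"
    using not_less_Least [of M "\<lambda>N. (T i ^^ N) w = z"] M unfolding N_def by simp
  moreover have "T i ((T i ^^ M) w) = z" using N M by simp
  ultimately show ?case using R by blast
qed (use v in blast)

section \<open>Zero divisors and units of the polynomial ring\<close>

lemma derivation_power_top:
  assumes D: "D \<in> derivations" and "(D ^^ Suc a) p = 0" "(D ^^ Suc b) q = 0"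
  shows "(D ^^ (a + b)) (p * q) = of_nat ((a + b) choose a) * ((D ^^ a) p * (D ^^ b) q)"
  using assms(2,3)
proof (induction "a + b" arbitrary: a b p q)
  case (Suc n)
  note d = derivationD [OF D]
  have pow_add: "(D ^^ N) (u + v) = (D ^^ N) u + (D ^^ N) v" for N u v
    by (induction N) (simp_all add: d)
  have zero: "(D ^^ N) 0 = 0" for N by (rule funpow_fixed_point) (rule d)
  \<comment> \<open>For \<open>a = 0\<close> the hypothesis says \<open>D p = 0\<close>. The case
    must be separated, since the truncated \<open>a - 1\<close> would give the wrong binomial
    coefficient. The two contributions add up by Pascal's rule.\<close>
  have l: "(D ^^ n) (D p * q) = (if a = 0 then 0 else of_nat ((a + b - 1) choose (a - 1)) * ((D ^^ a) p * (D ^^ b) q))"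
  proof (cases a)
    case 0
    with Suc.prems show ?thesis by (simp add: zero)
  next
    case (Suc a')
    then have "n = a' + b" using Suc.hyps by simp
    moreover have "(D ^^ Suc a') (D p) = 0" using Suc.prems Suc by (simp add: funpow_swap1)
    ultimately show ?thesis
      using Suc.hyps(1) [of a' b "D p" q] Suc.prems Suc by (simp add: funpow_swap1)
  qed
  have r: "(D ^^ n) (p * D q) = (if b = 0 then 0 else of_nat ((a + b - 1) choose a) * ((D ^^ a) p * (D ^^ b) q))"
  proof (cases b)
    case 0
    with Suc.prems show ?thesis by (simp add: zero)
  next
    case (Suc b')
    then have "n = a + b'" using Suc.hyps by simp
    moreover have "(D ^^ Suc b') (D q) = 0" using Suc.prems Suc by (simp add: funpow_swap1)
    ultimately show ?thesis
      using Suc.hyps(1) [of a b' p "D q"] Suc.prems Suc by (simp add: funpow_swap1)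
  qed
  have "(D ^^ (a + b)) (p * q) = (D ^^ n) (D p * q) + (D ^^ n) (p * D q)"
    unfolding Suc.hyps(2) [symmetric] by (simp add: funpow_swap1 d pow_add)
  also have "\<dots> = of_nat ((a + b) choose a) * ((D ^^ a) p * (D ^^ b) q)"
  proof -
    have "(a + b) choose a = (if a = 0 then 0 else (a + b - 1) choose (a - 1)) + (if b = 0 then 0 else (a + b - 1) choose a)"
      using Suc.hyps(2) by (cases a; cases b) auto
    then show ?thesis unfolding l r
      by (auto simp: algebra_simps)
  qed
  finally show ?case .
qed simp

lemma of_nat_mult_eq_0_iff:
  fixes p :: "('n, 'k::field_char_0) mpoly"
  assumes "a \<noteq> 0"
  shows "of_nat a * p = 0 \<longleftrightarrow> p = 0"
proof
  assume "of_nat a * p = 0"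
  then have "Poly_Mapping.lookup p m = 0" for m
    using assms lookup_Const_mult [of "of_nat a" p m] by (simp add: of_nat_mpoly)
  then show "p = 0" by (intro poly_mapping_eqI) simp
qed simp

lemma funpow_last_nonzero:
  fixes D :: "'a::zero \<Rightarrow> 'a"
  assumes "\<exists>N. (D ^^ N) p = 0" "p \<noteq> 0"
  obtains a where "(D ^^ a) p \<noteq> 0" "(D ^^ Suc a) p = 0"
proof -
  let ?N = "LEAST N. (D ^^ N) p = 0"
  have N: "(D ^^ ?N) p = 0" using assms(1) by (rule LeastI_ex)
  with assms(2) obtain a where a: "?N = Suc a" by (cases ?N) auto
  then have "(D ^^ a) p \<noteq> 0" using not_less_Least [of a "\<lambda>N. (D ^^ N) p = 0"] by simp
  with N a that show thesis by simp
qed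

text \<open>In a counterexample both factors can be replaced by their last nonzero iterates under
  \<open>partial i\<close>: by \<open>derivation_power_top\<close> these are the only survivors of
  Leibniz' rule, and the binomial coefficient is invertible. After all variables have been treated,
  two nonzero constants with product 0 remain.\<close>

lemma mpoly_no_zero_divisors:
  fixes p q :: "('n::finite, 'k::field_char_0) mpoly"
  assumes "p \<noteq> 0" "q \<noteq> 0"
  shows "p * q \<noteq> 0"
proof
  assume pq: "p * q = 0"
  have "\<exists>p' q' :: ('n, 'k) mpoly. p' \<noteq> 0 \<and> q' \<noteq> 0 \<and> p' * q' = 0 \<and> (\<forall>i\<in>S. partial i p' = 0 \<and> partial i q' = 0)"
    for S :: "'n set"
    using finite [of S]
  proof induction
    case (insert i S)
    from insert.IH obtain p' q' :: "('n, 'k) mpoly" where *: "p' \<noteq> 0" "q' \<noteq> 0" "p' * q' = 0"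
      "\<forall>i\<in>S. partial i p' = 0 \<and> partial i q' = 0" by (elim exE conjE)
    obtain a where a: "(partial i ^^ a) p' \<noteq> 0" "(partial i ^^ Suc a) p' = 0"
      using funpow_last_nonzero [OF partial_locally_nilpotent *(1)] .
    obtain b where b: "(partial i ^^ b) q' \<noteq> 0" "(partial i ^^ Suc b) q' = 0"
      using funpow_last_nonzero [OF partial_locally_nilpotent *(2)] .
    have "of_nat ((a + b) choose a) * ((partial i ^^ a) p' * (partial i ^^ b) q') = (0 :: ('n, 'k) mpoly)"
      using derivation_power_top [OF partial_derivation a(2) b(2)] *(3)
      by (simp add: funpow_fixed_point)
    then have "(partial i ^^ a) p' * (partial i ^^ b) q' = 0"
      by (subst (asm) of_nat_mult_eq_0_iff) auto
    moreover have "partial j ((partial i ^^ N) r) = (partial i ^^ N) (partial j r)"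
      for j N and r :: "('n, 'k) mpoly"
      by (induction N) (simp_all add: partial_commute)
    then have "partial j ((partial i ^^ a) p') = 0 \<and> partial j ((partial i ^^ b) q') = 0" if "j \<in> S" for j
      using that * by (simp add: funpow_fixed_point)
    ultimately show ?case using a b by (intro exI [of _ "(partial i ^^ a) p'"] exI [of _ "(partial i ^^ b) q'"]) auto
  qed (use assms pq in auto)
  from this [of UNIV] obtain p' q' :: "('n, 'k) mpoly" where *: "p' \<noteq> 0" "q' \<noteq> 0" "p' * q' = 0"
    "\<And>i. partial i p' = 0" "\<And>i. partial i q' = 0" by blast
  then obtain c d where "p' = Const c" "q' = Const d" by (metis Const_of_partials_zero)
  with * show False by (simp flip: Const_mult)
qed

text \<open>If \<open>a\<close> and \<open>b\<close> are the orders of the last nonzero iterates of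
  \<open>p\<close> and \<open>q\<close> under \<open>partial i\<close>, then the iterate of order
  \<open>a + b\<close> does not kill the product 1, which forces \<open>a + b = 0\<close>.\<close>

lemma mpoly_unit_Const:
  fixes p q :: "('n::finite, 'k::field_char_0) mpoly"
  assumes "p * q = 1"
  obtains c where "p = Const c" "c \<noteq> 0"
proof -
  have nz: "p \<noteq> 0" "q \<noteq> 0" using assms by auto
  have "partial i p = 0" for i
  proof -
    obtain a where a: "(partial i ^^ a) p \<noteq> 0" "(partial i ^^ Suc a) p = 0"
      using funpow_last_nonzero [OF partial_locally_nilpotent nz(1)] .
    obtain b where b: "(partial i ^^ b) q \<noteq> 0" "(partial i ^^ Suc b) q = 0"
      using funpow_last_nonzero [OF partial_locally_nilpotent nz(2)] .
    have "of_nat ((a + b) choose a) * ((partial i ^^ a) p * (partial i ^^ b) q) \<noteq> 0"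
      using mpoly_no_zero_divisors [OF a(1) b(1)] by (subst of_nat_mult_eq_0_iff) auto
    then have "(partial i ^^ (a + b)) 1 \<noteq> (0 :: ('n, 'k) mpoly)"
      using derivation_power_top [OF partial_derivation a(2) b(2)] assms by simp
    moreover have "(partial i ^^ N) 1 = (0 :: ('n, 'k) mpoly)" if "N > 0" for N
      using that
    proof (cases N)
      case (Suc M)
      have "partial i (1 :: ('n, 'k) mpoly) = 0" by (metis Const_1 partial_Const)
      with Suc show ?thesis by (simp add: funpow_swap1 funpow_fixed_point)
    qed simp
    ultimately have "a = 0" by (metis add_gr_0 not_gr0)
    with a show ?thesis by simp
  qed
  then obtain c where "p = Const c" by (metis Const_of_partials_zero)
  with nz that show thesis by auto
qed

lemma mpoly_ring_induct [case_names Const Var add mult]: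
  fixes p :: "('n::finite, 'k::field_char_0) mpoly"
  assumes "\<And>c. P (Const c)" "\<And>i. P (Var i)"
    and "\<And>p q. P p \<Longrightarrow> P q \<Longrightarrow> P (p + q)" "\<And>p q. P p \<Longrightarrow> P q \<Longrightarrow> P (p * q)"
  shows "P p"
proof (induction p rule: mpoly_induct)
  case zero
  show ?case using assms(1) [of 0] by simp
next
  case (add p m c)
  have pw: "Poly_Mapping.single (Poly_Mapping.single i a) (1::'k) = Var i ^ a" for i :: 'n and a :: nat
  proof (induction a)
    case (Suc a)
    have "Poly_Mapping.single (Poly_Mapping.single i (Suc a)) (1::'k) =
        Var i * Poly_Mapping.single (Poly_Mapping.single i a) 1"
      by (simp add: Var_def mult_single flip: single_add)
    with Suc show ?case by simp
  qed simp
  have prod: "(\<Prod>i\<in>S. Poly_Mapping.single (f i) (1::'k)) = Poly_Mapping.single (sum f S) 1"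
    for f :: "'n \<Rightarrow> 'n \<Rightarrow>\<^sub>0 nat" and S
    by (induction S rule: infinite_finite_induct) (simp_all add: mult_single)
  have "m = (\<Sum>i\<in>UNIV. Poly_Mapping.single i (Poly_Mapping.lookup m i))"
    by (intro poly_mapping_eqI) (simp add: lookup_sum lookup_single when_def)
  then have "Poly_Mapping.single m c = Const c * (\<Prod>i\<in>UNIV. Var i ^ Poly_Mapping.lookup m i)"
    unfolding pw [symmetric] prod by (simp add: Const_def mult_single)
  moreover have "P (Var i ^ a)" for i a
  proof (induction a)
    case 0 show ?case using assms(1) [of 1] by simp
  qed (use assms in simp)
  then have "P (\<Prod>i\<in>S. Var i ^ Poly_Mapping.lookup m i)" for S
    by (induction S rule: infinite_finite_induct) (use assms(1) [of 1] assms(4) in simp_all)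
  ultimately show ?case using add assms by simp
qed

section \<open>Determinants\<close>

lemma det_row_replace:
  fixes M :: "'a::comm_ring_1^'n^'n"
  shows "det (\<chi> i. if i = k then h else M $ i) =
    (\<Sum>p | p permutes UNIV. of_int (sign p) * (h $ p k * (\<Prod>i\<in>UNIV - {k}. M $ i $ p i)))"
proof -
  have "(\<Prod>i\<in>UNIV. (\<chi> i. if i = k then h else M $ i) $ i $ p i) =
      h $ p k * (\<Prod>i\<in>UNIV - {k}. M $ i $ p i)" for p
    by (subst prod.remove [of _ k]) (auto intro!: prod.cong)
  then show ?thesis by (simp add: det_def)
qed

text \<open>Both sides are the derivative of the determinant at \<open>M\<close> in direction
  \<open>H\<close>, which transposition does not change. In the permutation expansion the term of
  \<open>p\<close> matches that of its inverse.\<close>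

lemma sum_det_row_replace_transpose:
  fixes M H :: "'a::comm_ring_1^'n^'n"
  shows "(\<Sum>k\<in>UNIV. det (\<chi> i. if i = k then H $ k else M $ i)) =
    (\<Sum>k\<in>UNIV. det (\<chi> i. if i = k then Finite_Cartesian_Product.transpose H $ k
      else Finite_Cartesian_Product.transpose M $ i))"
proof -
  let ?t = "Finite_Cartesian_Product.transpose"
  define g where "g M H p =
      of_int (sign p) * (\<Sum>k\<in>UNIV. H $ k $ p k * (\<Prod>i\<in>UNIV - {k}. M $ i $ p i))"
    for M H :: "'a^'n^'n" and p
  have d: "(\<Sum>k\<in>UNIV. det (\<chi> i. if i = k then H $ k else M $ i)) = (\<Sum>p | p permutes UNIV. g M H p)"
    for M H :: "'a^'n^'n"
    unfolding det_row_replace g_def by (subst sum.swap) (simp add: sum_distrib_left)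
  have "g M H p = g (?t M) (?t H) (inv_into UNIV p)" if p: "p permutes UNIV" for p
  proof -
    have b: "bij p" using p by (simp add: permutes_bij)
    have i: "inv_into UNIV p (p x) = x" for x using b by (simp add: bij_is_inj)
    have "(\<Sum>k\<in>UNIV. ?t H $ k $ inv_into UNIV p k * (\<Prod>i\<in>UNIV - {k}. ?t M $ i $ inv_into UNIV p i)) =
        (\<Sum>k\<in>UNIV. ?t H $ p k $ inv_into UNIV p (p k) *
          (\<Prod>i\<in>UNIV - {p k}. ?t M $ i $ inv_into UNIV p i))"
      by (rule sum.reindex_bij_betw [OF b, symmetric])
    also have "\<dots> = (\<Sum>k\<in>UNIV. H $ k $ p k * (\<Prod>i\<in>UNIV - {k}. M $ i $ p i))"
    proof (rule sum.cong [OF refl])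
      fix k
      have bb: "bij_betw p (UNIV - {k}) (UNIV - {p k})"
        using b by (intro bij_betw_DiffI) (auto simp: bij_betw_def)
      show "?t H $ p k $ inv_into UNIV p (p k) * (\<Prod>i\<in>UNIV - {p k}. ?t M $ i $ inv_into UNIV p i) =
          H $ k $ p k * (\<Prod>i\<in>UNIV - {k}. M $ i $ p i)"
        unfolding prod.reindex_bij_betw [OF bb, symmetric] by (simp add: i transpose_def)
    qed
    finally show ?thesis
      using p unfolding g_def by (simp add: sign_inverse permutes_imp_permutation)
  qed
  then have "(\<Sum>p | p permutes UNIV. g M H p) =
      (\<Sum>p | p permutes UNIV. g (?t M) (?t H) (inv_into UNIV p))" by simp
  also have "\<dots> = (\<Sum>p | p permutes UNIV. g (?t M) (?t H) p)"
    by (rule sum_permutations_inverse [symmetric])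
  finally show ?thesis unfolding d .
qed

text \<open>By multilinearity and alternation only the multiple of row \<open>k\<close> itself
  survives.\<close>

lemma det_row_combination:
  fixes M :: "'a::comm_ring_1^'n^'n"
  shows "det (\<chi> i. if i = k then (\<Sum>l\<in>UNIV. a l *s M $ l) else M $ i) = a k * det M"
proof -
  have z: "det (\<chi> i. if i = k then M $ l else M $ i) = (if l = k then det M else 0)" for l
  proof (cases "l = k")
    case True
    then have "(\<chi> i. if i = k then M $ l else M $ i) = M" by (simp add: vec_eq_iff)
    with True show ?thesis by simp
  next
    case False
    then show ?thesis by (simp add: det_identical_rows [of l k] row_def)
  qed
  have "det (\<chi> i. if i = k then (\<Sum>l\<in>UNIV. a l *s M $ l) else M $ i) =
      (\<Sum>l\<in>UNIV. a l * (if l = k then det M else 0))"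
    unfolding det_linear_row_sum [OF finite] det_row_mul z ..
  also have "\<dots> = (\<Sum>l\<in>UNIV. if l = k then a l * det M else 0)"
    by (intro sum.cong) auto
  finally show ?thesis by simp
qed

text \<open>This is Jacobi's formula for the derivative of the determinant in direction
  \<open>M ** J\<close>. The columns of \<open>M ** J\<close> are combinations of the columns of
  \<open>M\<close>, so after transposition \<open>det_row_combination\<close> applies to each
  summand.\<close>

lemma sum_det_row_replace_mult:
  fixes M J :: "'a::comm_ring_1^'n^'n"
  shows "(\<Sum>k\<in>UNIV. det (\<chi> i. if i = k then (M ** J) $ k else M $ i)) = trace J * det M"
proof -
  let ?t = "Finite_Cartesian_Product.transpose"
  have "det (\<chi> i. if i = k then ?t (M ** J) $ k else ?t M $ i) = J $ k $ k * det M" for k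
  proof -
    have e: "?t (M ** J) $ k = (\<Sum>l\<in>UNIV. J $ l $ k *s ?t M $ l)"
      by (simp add: vec_eq_iff transpose_def matrix_matrix_mult_def mult.commute)
    show ?thesis unfolding e det_row_combination det_transpose ..
  qed
  then show ?thesis
    unfolding sum_det_row_replace_transpose [of "M ** J"] by (simp add: trace_def sum_distrib_right)
qed

text \<open>Cramer's rule without division is Jacobi's formula for the matrix \<open>?J\<close>
  whose row \<open>j\<close> is \<open>v\<close> and whose other rows vanish: its trace is the
  \<open>j\<close>-th entry of \<open>v\<close>.\<close>

lemma cramer_rows:
  fixes M :: "'a::comm_ring_1^'n^'n"
  shows "(\<Sum>k\<in>UNIV. det (\<chi> i. if i = k then v else M $ i) * M $ k $ j) = det M * v $ j"
proof -
  let ?J = "\<chi> a b. if a = j then v $ b else 0"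
  have "(M ** ?J) $ k = M $ k $ j *s v" for k
    by (simp add: vec_eq_iff matrix_matrix_mult_def if_distrib [where f = "(*) _"] cong: if_cong)
  moreover have "trace ?J = v $ j" by (simp add: trace_def)
  ultimately show ?thesis
    using sum_det_row_replace_mult [of M ?J] by (simp only: det_row_mul mult.commute)
qed

lemma derivation_prod:
  assumes D: "D \<in> derivations" and "finite S"
  shows "D (prod f S) = (\<Sum>k\<in>S. D (f k) * prod f (S - {k}))"
  using \<open>finite S\<close>
proof induction
  case (insert x S)
  have "prod f (insert x S - {k}) = f x * prod f (S - {k})" if "k \<in> S" for k
  proof -
    have "insert x S - {k} = insert x (S - {k})" using that insert by auto
    with insert show ?thesis by simp
  qed
  then have "(\<Sum>k\<in>S. D (f k) * prod f (insert x S - {k})) = f x * (\<Sum>k\<in>S. D (f k) * prod f (S - {k}))"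
    by (simp add: sum_distrib_left mult.left_commute)
  with insert show ?case by (simp add: derivationD(2) [OF D])
qed (simp add: derivationD(6) [OF D])

lemma derivation_det:
  fixes M :: "('n::finite, 'k::field_char_0) mpoly^'m^'m"
  assumes D: "D \<in> derivations"
  shows "D (det M) = (\<Sum>k\<in>UNIV. det (\<chi> i. if i = k then (\<chi> j. D (M $ k $ j)) else M $ i))"
proof -
  have s: "D (of_int (sign p) * q) = of_int (sign p) * D q" for p :: "'m \<Rightarrow> 'm" and q
    using derivationD(7) [OF D, of 0 q] by (simp add: sign_def derivationD(4) [OF D])
  show ?thesis
    unfolding det_row_replace det_def [of M]
    by (subst sum.swap) (simp add: derivationD(8) [OF D] s derivation_prod [OF D] sum_distrib_left)
qed

section \<open>Frames of derivations\<close>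

text \<open>For derivations \<open>E i\<close> this is the coefficient of their exterior product
  relative to that of the fields \<open>partial i\<close>; row \<open>i\<close> holds the components
  of \<open>E i\<close>.\<close>

definition frame_det :: "('n::finite \<Rightarrow> ('n, 'k::field_char_0) mpoly \<Rightarrow> ('n, 'k) mpoly) \<Rightarrow> ('n, 'k) mpoly"
  where "frame_det E = det (\<chi> i j. E i (Var j))"

lemma frame_det_upd:
  "frame_det (E(k := D)) = det (\<chi> i. if i = k then (\<chi> j. D (Var j)) else (\<chi> i j. E i (Var j)) $ i)"
  unfolding frame_det_def by (rule arg_cong [where f = det]) (simp add: vec_eq_iff)

text \<open>The Lie derivative of a polyvector field of top degree; the divergence is the trace of the
  Jacobian matrix of \<open>D\<close>.\<close>

lemma derivation_frame_det:
  assumes D: "D \<in> derivations" and E: "\<And>i. E i \<in> derivations"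
  shows "D (frame_det E) = divergence D * frame_det E + (\<Sum>k\<in>UNIV. frame_det (E(k := bracket D (E k))))"
proof -
  let ?M = "\<chi> i j. E i (Var j)" and ?J = "\<chi> l j. partial l (D (Var j))"
  \<comment> \<open>Here \<open>D (E k (Var j))\<close> is rewritten as
    \<open>E k (D (Var j))\<close> plus the bracket. Expanding \<open>E k\<close> in the partial
    derivatives turns the first term into a row of \<open>?M ** ?J\<close>.\<close>
  have row: "(\<chi> j. D (?M $ k $ j)) = (?M ** ?J) $ k + (\<chi> j. bracket D (E k) (Var j))" for k
  proof -
    have "E k p = (\<Sum>l\<in>UNIV. E k (Var l) * partial l p)" for p
      using derivation_expansion [OF E [of k]] by metis
    from this [of "D (Var _)"] show ?thesis
      by (simp add: vec_eq_iff bracket_def matrix_matrix_mult_def)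
  qed
  have tr: "trace ?J = divergence D" by (simp add: trace_def divergence_def)
  have "D (frame_det E) = (\<Sum>k\<in>UNIV. det (\<chi> i. if i = k then (?M ** ?J) $ k else ?M $ i)) +
      (\<Sum>k\<in>UNIV. frame_det (E(k := bracket D (E k))))"
    unfolding frame_det_def derivation_det [OF D] row det_row_add sum.distrib
      frame_det_upd [unfolded frame_det_def] ..
  then show ?thesis
    unfolding sum_det_row_replace_mult tr by (simp add: frame_det_def)
qed

lemma zero_derivation: "(\<lambda>p. 0) \<in> derivations"
  by (rule derivationI) auto

lemma frame_det_zero:
  assumes "E k = (\<lambda>p. 0)"
  shows "frame_det E = 0"
proof -
  have "(\<chi> i j. E i (Var j)) = (\<chi> i. if i = k then 0 else (\<chi> j. E i (Var j)))"
    by (simp add: vec_eq_iff assms)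
  then show ?thesis unfolding frame_det_def by (simp only: det_row_0)
qed

lemma derivations_combination:
  assumes "\<And>i. E i \<in> derivations"
  shows "(\<lambda>p. \<Sum>i\<in>S. a i * E i p) \<in> derivations"
  by (rule derivationI) (simp_all add: derivationD [OF assms] distrib_left sum.distrib
      sum_distrib_left sum_distrib_right mult_ac)

lemma derivations_mult:
  assumes "D \<in> derivations"
  shows "(\<lambda>p. a * D p) \<in> derivations"
  by (rule derivationI) (simp_all add: derivationD [OF assms] distrib_left mult_ac)

text \<open>Both sides are derivations in \<open>p\<close>, so it suffices to compare them on the
  variables, where the identity is Cramer's rule.\<close>

lemma frame_expansion:
  assumes D: "D \<in> derivations" and E: "\<And>i. E i \<in> derivations"
  shows "frame_det E * D p = (\<Sum>k\<in>UNIV. frame_det (E(k := D)) * E k p)"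
proof -
  have "(\<lambda>p. frame_det E * D p) = (\<lambda>p. \<Sum>k\<in>UNIV. frame_det (E(k := D)) * E k p)"
  proof (rule derivations_eqI [OF derivations_mult [OF D] derivations_combination [OF E]])
    fix j
    show "frame_det E * D (Var j) = (\<Sum>k\<in>UNIV. frame_det (E(k := D)) * E k (Var j))"
      using cramer_rows [of "\<chi> j. D (Var j)" "\<chi> i j. E i (Var j)" j]
      by (simp add: frame_det_upd) (simp add: frame_det_def)
  qed
  then show ?thesis by metis
qed

lemma frame_det_swap:
  assumes "a \<noteq> b"
  shows "frame_det (E(a := E b, b := E a)) = - frame_det E"
proof -
  have "frame_det (E(a := E b, b := E a)) =
      det (\<chi> i. (\<chi> i j. E i (Var j)) $ Transposition.transpose a b i)"
    unfolding frame_det_def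
    by (rule arg_cong [where f = det]) (auto simp: vec_eq_iff Transposition.transpose_def)
  also have "\<dots> = of_int (sign (Transposition.transpose a b)) * frame_det E"
    unfolding frame_det_def by (rule det_permute_rows) (simp add: permutes_swap_id)
  finally show ?thesis using assms by (simp add: sign_swap_id)
qed

lemma frame_det_partial: "frame_det partial = (1 :: ('n::finite, 'k::field_char_0) mpoly)"
proof -
  have "(\<chi> i j. partial i (Var j)) = (mat 1 :: ('n, 'k) mpoly^'n^'n)"
    by (simp add: vec_eq_iff mat_def partial_Var)
  then show ?thesis unfolding frame_det_def by (simp only: det_I)
qed

section \<open>Vector fields of constant divergence\<close>

lemma frame_det_scale: "frame_det (E(k := (\<lambda>p. a * D p))) = a * frame_det (E(k := D))"
proof -
  have "(\<chi> j. a * D (Var j)) = a *s (\<chi> j. D (Var j))" by (simp add: vec_eq_iff)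
  then show ?thesis unfolding frame_det_upd by (simp only: det_row_mul)
qed

lemma divergence_mult:
  assumes "D \<in> derivations"
  shows "divergence (\<lambda>p. a * D p) = D a + a * divergence D"
proof -
  have "D a = (\<Sum>i\<in>UNIV. D (Var i) * partial i a)"
    using derivation_expansion [OF assms] by metis
  then show ?thesis
    by (simp add: divergence_def partial_mult sum.distrib sum_distrib_left mult.commute)
qed

lemma divergence_partial: "divergence (partial i) = 0"
  unfolding divergence_def
  by (intro sum.neutral) (metis partial_Const partial_Var Const_0 Const_1)

lemma div_constI: "D \<in> derivations \<Longrightarrow> divergence D = Const c \<Longrightarrow> D \<in> div_const"
  by (auto simp: div_const_def)

lemma partial_div_const: "partial i \<in> div_const"
  by (rule div_constI [OF partial_derivation, of _ 0]) (simp add: divergence_partial)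

lemma Var_partial_div_const: "(\<lambda>p. Var i * partial j p) \<in> div_const"
proof -
  have "divergence (\<lambda>p. Var i * partial j p) = Const (if i = j then 1 else 0)"
    by (simp add: divergence_mult [OF partial_derivation] divergence_partial partial_Var)
  then show ?thesis by (rule div_constI [OF derivations_mult [OF partial_derivation]])
qed

section \<open>The Euler field\<close>

definition euler :: "('n::finite, 'k::field_char_0) mpoly \<Rightarrow> ('n, 'k) mpoly"
  where "euler p = (\<Sum>i\<in>UNIV. Var i * partial i p)"

lemma euler_derivation: "euler \<in> derivations"
  unfolding euler_def by (rule combination_derivation)

lemma euler_Var [simp]: "euler (Var i) = Var i"
  by (simp add: euler_def combination_Var)

lemma euler_div_const: "euler \<in> div_const"
  by (rule div_constI [OF euler_derivation, where c = "of_nat CARD('a)"])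
    (simp add: divergence_def partial_Var of_nat_mpoly)

lemma div_const_derivation: "D \<in> div_const \<Longrightarrow> D \<in> derivations"
  by (simp add: div_const_def)

lemma div_const_zero: "(\<lambda>p. 0) \<in> div_const"
  using div_const_scale [OF partial_div_const, of 0] by simp

lemma bracket_partial_Var: "bracket (partial i) D (Var j) = partial i (D (Var j))" if "D \<in> derivations"
  using derivationD(4,6) [OF that] by (simp add: bracket_def partial_Var)

lemma bracket_partial_euler: "bracket (partial i) euler = partial i"
  by (rule derivations_eqI)
    (simp_all add: derivations_bracket partial_derivation euler_derivation bracket_partial_Var)

section \<open>Degree bounds for vector fields\<close>

definition vf_below :: "nat \<Rightarrow> (('n::finite, 'k::field_char_0) mpoly \<Rightarrow> ('n, 'k) mpoly) \<Rightarrow> bool"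
  where "vf_below N D \<longleftrightarrow> (\<forall>j. below N (D (Var j)))"

lemma ex_vf_below: "\<exists>N. vf_below N D"
proof -
  have "\<forall>j. \<exists>N. below N (D (Var j))" by (simp add: ex_below)
  then obtain f where f: "\<And>j. below (f j) (D (Var j))" by metis
  have "f j \<le> sum f UNIV" for j by (rule member_le_sum) auto
  with f below_mono show ?thesis unfolding vf_below_def by blast
qed

text \<open>The bracket with \<open>partial i\<close> differentiates every component. Together with
  \<open>vf_below_0\<close> this makes it locally nilpotent on derivations, a property that an
  automorphism transports.\<close>

lemma vf_below_bracket_partial:
  "D \<in> derivations \<Longrightarrow> vf_below N D \<Longrightarrow> vf_below (N - 1) (bracket (partial i) D)"
  using below_partial by (auto simp: vf_below_def bracket_partial_Var)

lemma vf_below_0: "D \<in> derivations \<Longrightarrow> vf_below 0 D \<Longrightarrow> D = (\<lambda>p. 0)"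
  by (rule derivations_eqI) (simp_all add: zero_derivation vf_below_def)

lemma below_Const: "below 1 (Const c)"
  by (simp add: below_def lookup_Const)

lemma partial_Var_Const: "partial i (Var j) = Const (if i = j then 1 else 0)"
  by (simp add: partial_Var)

lemma vf_below_1_partial: "vf_below 1 (partial i)"
  unfolding vf_below_def partial_Var_Const by (intro allI below_Const)

lemma sum_fun_upd:
  fixes m :: "'n::finite \<Rightarrow> nat"
  shows "sum (m(k := a)) UNIV + m k = sum m UNIV + a"
proof -
  have "sum (m(k := a)) (UNIV - {k}) = sum m (UNIV - {k})" by (intro sum.cong) auto
  then show ?thesis
    using sum.remove [of UNIV k m] sum.remove [of UNIV k "m(k := a)"] by simp
qed

text \<open>In each term of Leibniz' rule one factor is differentiated often enough to vanish. The
  exponent \<open>a + b\<close> is not sharp but keeps the induction free of subtraction.\<close>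

lemma derivation_nilpotent_mult:
  assumes D: "D \<in> derivations" and "(D ^^ a) p = 0" "(D ^^ b) q = 0"
  shows "(D ^^ (a + b)) (p * q) = 0"
  using assms(2,3)
proof (induction "a + b" arbitrary: a b p q)
  case 0
  then show ?case by simp
next
  case (Suc n)
  note d = derivationD [OF D]
  have pow_add: "(D ^^ N) (u + v) = (D ^^ N) u + (D ^^ N) v" for N u v
    by (induction N) (simp_all add: d)
  have zero: "(D ^^ N) 0 = 0" for N by (rule funpow_fixed_point) (rule d)
  have l: "(D ^^ n) (D p * q) = 0"
  proof (cases a)
    case 0
    with Suc.prems show ?thesis by (simp add: zero d)
  next
    case (Suc a')
    with Suc.hyps(1) [of a' b "D p" q] Suc.hyps(2) Suc.prems show ?thesis
      by (simp add: funpow_swap1)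
  qed
  have r: "(D ^^ n) (p * D q) = 0"
  proof (cases b)
    case 0
    with Suc.prems show ?thesis by (simp add: zero d)
  next
    case (Suc b')
    with Suc.hyps(1) [of a b' p "D q"] Suc.hyps(2) Suc.prems show ?thesis
      by (simp add: funpow_swap1)
  qed
  show ?case
    unfolding Suc.hyps(2) [symmetric] by (simp add: funpow_swap1 d pow_add l r)
qed

section \<open>Automorphisms of the Lie algebra\<close>

locale div_const_aut =
  fixes \<phi> :: "(('n::finite, 'k::field_char_0) mpoly \<Rightarrow> ('n, 'k) mpoly) \<Rightarrow> ('n, 'k) mpoly \<Rightarrow> ('n, 'k) mpoly"
  assumes \<phi>: "\<phi> \<in> lie_auts div_const"
begin

lemma mem: "D \<in> div_const \<Longrightarrow> \<phi> D \<in> div_const"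
  by (rule lie_autsD(2) [OF \<phi>])

lemma deriv: "D \<in> div_const \<Longrightarrow> \<phi> D \<in> derivations"
  by (rule div_const_derivation [OF mem])

lemma add: "D \<in> div_const \<Longrightarrow> E \<in> div_const \<Longrightarrow> \<phi> (\<lambda>p. D p + E p) = (\<lambda>p. \<phi> D p + \<phi> E p)"
  by (rule lie_autsD(3) [OF \<phi>])

lemma scale: "D \<in> div_const \<Longrightarrow> \<phi> (\<lambda>p. Const c * D p) = (\<lambda>p. Const c * \<phi> D p)"
  by (rule lie_autsD(4) [OF \<phi>])

lemma bracket: "D \<in> div_const \<Longrightarrow> E \<in> div_const \<Longrightarrow> \<phi> (bracket D E) = bracket (\<phi> D) (\<phi> E)"
  by (rule lie_autsD(5) [OF \<phi>])

lemma bij: "bij_betw \<phi> div_const div_const"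
  using lie_autsD(1) [OF \<phi>] by (simp add: Bij_def)

lemma surj: 
  assumes "B \<in> div_const"
  obtains D where "D \<in> div_const" "\<phi> D = B"
proof -
  have "B \<in> \<phi> ` div_const" using bij assms by (simp add: bij_betw_def)
  with that show thesis by (elim imageE) simp
qed

lemma zero: "\<phi> (\<lambda>p. 0) = (\<lambda>p. 0)"
  using scale [OF div_const_zero, of 0] by simp

lemma eq_zeroD: "D \<in> div_const \<Longrightarrow> \<phi> D = (\<lambda>p. 0) \<Longrightarrow> D = (\<lambda>p. 0)"
  using bij div_const_zero zero unfolding bij_betw_def inj_on_def by metis

lemma sum_scaled:
  assumes "finite S" "\<And>i. i \<in> S \<Longrightarrow> D i \<in> div_const"
  shows "(\<lambda>p. \<Sum>i\<in>S. Const (c i) * D i p) \<in> div_const"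
    and "\<phi> (\<lambda>p. \<Sum>i\<in>S. Const (c i) * D i p) = (\<lambda>p. \<Sum>i\<in>S. Const (c i) * \<phi> (D i) p)"
  using assms
proof (induction S)
  case empty
  {
    case 1 show ?case using div_const_zero by simp
  next
    case 2 show ?case using zero by simp
  }
next
  case (insert x S)
  {
    case 1
    then have "D x \<in> div_const" "(\<lambda>p. \<Sum>i\<in>S. Const (c i) * D i p) \<in> div_const"
      using insert.IH(1) by simp_all
    from div_const_add [OF div_const_scale [OF this(1), of "c x"] this(2)] show ?case
      using insert.hyps by simp
  next
    case 2
    then have x: "D x \<in> div_const" and S: "(\<lambda>p. \<Sum>i\<in>S. Const (c i) * D i p) \<in> div_const"
      and i: "\<phi> (\<lambda>p. \<Sum>i\<in>S. Const (c i) * D i p) = (\<lambda>p. \<Sum>i\<in>S. Const (c i) * \<phi> (D i) p)"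
      using insert.IH by simp_all
    from add [OF div_const_scale [OF x, of "c x"] S] show ?case
      using insert.hyps by (simp add: i scale [OF x])
  }
qed

section \<open>The images of the partial derivatives\<close>

definition \<delta> :: "'n \<Rightarrow> ('n, 'k) mpoly \<Rightarrow> ('n, 'k) mpoly"
  where "\<delta> i = \<phi> (partial i)"

lemma \<delta>_mem: "\<delta> i \<in> div_const"
  unfolding \<delta>_def by (rule mem [OF partial_div_const])

lemma \<delta>_deriv: "\<delta> i \<in> derivations"
  by (rule div_const_derivation [OF \<delta>_mem])

lemmas \<delta>D = derivationD [OF \<delta>_deriv]

lemma bracket_\<delta>: "D \<in> div_const \<Longrightarrow> bracket (\<delta> i) (\<phi> D) = \<phi> (bracket (partial i) D)"
  unfolding \<delta>_def by (simp add: bracket partial_div_const)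

lemma \<delta>_commute: "\<delta> i (\<delta> j p) = \<delta> j (\<delta> i p)"
proof -
  have "bracket (partial i) (partial j) = (\<lambda>p :: ('n, 'k) mpoly. 0)" by (simp add: bracket_def partial_commute)
  then have "bracket (\<delta> i) (\<delta> j) = (\<lambda>p. 0)"
    unfolding \<delta>_def [of j] bracket_\<delta> [OF partial_div_const] by (simp only: zero)
  then show ?thesis by (simp add: bracket_def fun_eq_iff)
qed

lemma \<delta>_independent_Const:
  assumes "\<And>p. (\<Sum>i\<in>UNIV. Const (c i) * \<delta> i p) = 0"
  shows "c j = 0"
proof -
  note s = sum_scaled [OF finite partial_div_const, of c]
  have "\<phi> (\<lambda>p. \<Sum>i\<in>UNIV. Const (c i) * partial i p) = (\<lambda>p. 0)"
    using assms unfolding s(2) \<delta>_def by simp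
  then have "(\<Sum>i\<in>UNIV. Const (c i) * partial i (Var j)) = 0"
    by (rule fun_cong [OF eq_zeroD [OF s(1)]])
  then show ?thesis by (simp add: combination_Var)
qed

lemma \<delta>_nonzero:
  obtains p where "\<delta> i p \<noteq> 0"
proof (rule ccontr)
  assume "\<not> thesis"
  with that have "\<And>p. \<delta> i p = 0" by blast
  then have "(\<Sum>k\<in>UNIV. Const (if k = i then 1 else 0) * \<delta> k p) = 0" for p
    by (intro sum.neutral) auto
  from \<delta>_independent_Const [OF this, of i] show False by simp
qed

lemma \<delta>_cancel: "(\<And>p. a * \<delta> i p = 0) \<Longrightarrow> a = 0"
  using \<delta>_nonzero [of i] mpoly_no_zero_divisors by metis

text \<open>Pulling back along \<open>\<phi>\<close> reduces this to the centralizer of the partial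
  derivatives, which consists of the fields with constant components.\<close>

lemma \<delta>_centralizer:
  assumes B: "B \<in> div_const" and c: "\<And>i. bracket (\<delta> i) B = (\<lambda>p. 0)"
  obtains c where "\<And>p. B p = (\<Sum>i\<in>UNIV. Const (c i) * \<delta> i p)"
proof -
  obtain D where D: "D \<in> div_const" "\<phi> D = B" using surj [OF B] .
  have "bracket (partial i) D = (\<lambda>p. 0)" for i
    by (rule eq_zeroD [OF div_const_bracket [OF partial_div_const D(1)]])
      (use c bracket_\<delta> [OF D(1)] D in simp)
  then have "partial i (D (Var j)) = 0" for i j
    using bracket_partial_Var [OF div_const_derivation [OF D(1)]] by metis
  then have "\<exists>c. D (Var j) = Const c" for j by (metis Const_of_partials_zero)
  then obtain c where c: "\<And>j. D (Var j) = Const (c j)" by metis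
  have "D = (\<lambda>p. \<Sum>i\<in>UNIV. Const (c i) * partial i p)"
    using derivation_expansion [OF div_const_derivation [OF D(1)]] unfolding c .
  then have "B = (\<lambda>p. \<Sum>i\<in>UNIV. Const (c i) * \<delta> i p)"
    unfolding D(2) [symmetric] \<delta>_def
    by (simp add: sum_scaled(2) [OF finite partial_div_const])
  with that show thesis by simp
qed

text \<open>By \<open>derivation_frame_det\<close>, one application of the operator gives a sum of
  frame determinants in which one preimage \<open>E k\<close> is replaced by its bracket with
  \<open>partial t\<close>. Each replacement lowers the total degree bound by one.\<close>

lemma frame_det_nilpotent:
  assumes "\<And>i. E i \<in> div_const" "\<And>i. vf_below (m i) (E i)" "N = sum m UNIV"
  shows "((\<lambda>q. \<delta> t q - divergence (\<delta> t) * q) ^^ N) (frame_det (\<lambda>i. \<phi> (E i))) = 0"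
  using assms
proof (induction N arbitrary: E m)
  case 0
  then have "m i = 0" for i by simp
  \<comment> \<open>Since the index type is nonempty, there is at least one zero row, so the
    determinant vanishes.\<close>
  then have "E i = (\<lambda>p. 0)" for i
    using vf_below_0 [OF div_const_derivation [OF 0(1)]] 0(2) [of i] by simp
  then show ?case using zero by (simp add: frame_det_zero)
next
  case (Suc N)
  let ?T = "\<lambda>q. \<delta> t q - divergence (\<delta> t) * q"
  let ?E = "\<lambda>k. E(k := bracket (partial t) (E k))"
  have Tz: "(?T ^^ M) 0 = 0" for M
    by (rule funpow_fixed_point) (simp add: \<delta>D)
  have Ts: "(?T ^^ M) (sum f S) = (\<Sum>k\<in>S. (?T ^^ M) (f k))" for M S and f :: "'n \<Rightarrow> _"
    by (induction M) (simp_all add: \<delta>D sum_distrib_left sum_subtractf)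
  have upd: "(\<lambda>i. \<phi> (E i))(k := bracket (\<delta> t) (\<phi> (E k))) = (\<lambda>i. \<phi> (?E k i))" for k
    using bracket_\<delta> Suc.prems(1) by auto
  have "?T (frame_det (\<lambda>i. \<phi> (E i))) = (\<Sum>k\<in>UNIV. frame_det (\<lambda>i. \<phi> (?E k i)))"
    using derivation_frame_det [OF \<delta>_deriv [of t], of "\<lambda>i. \<phi> (E i)"] deriv Suc.prems(1)
    by (simp only: upd) simp
  moreover have "(?T ^^ N) (frame_det (\<lambda>i. \<phi> (?E k i))) = 0" for k
  proof (cases "m k")
    case 0
    \<comment> \<open>Here the bound of \<open>E k\<close> cannot drop further, but the field is
      already zero and so is its bracket.\<close>
    have "E k = (\<lambda>p. 0)"
      using vf_below_0 div_const_derivation Suc.prems 0 by metis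
    then have "\<phi> (?E k k) = (\<lambda>p. 0)" by (simp add: bracket_def zero)
    then show ?thesis by (simp add: frame_det_zero [of _ k] Tz)
  next
    case (Suc m')
    show ?thesis
    proof (rule Suc.IH [of "?E k" "m(k := m')"])
      show "?E k i \<in> div_const" for i
        using Suc.prems(1) by (simp add: div_const_bracket partial_div_const)
      show "vf_below ((m(k := m')) i) (?E k i)" for i
        using vf_below_bracket_partial [OF div_const_derivation [OF Suc.prems(1)] Suc.prems(2), of k t]
          Suc Suc.prems(2) [of i] by simp
      show "N = sum (m(k := m')) UNIV"
        using Suc Suc.prems(3) sum_fun_upd [of m k m'] by simp
    qed
  qed
  ultimately show ?case by (simp only: funpow_Suc_right o_apply Ts) simp
qed

lemma ex_frame_det_nilpotent:
  assumes "\<And>i. B i \<in> div_const"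
  shows "\<exists>N. ((\<lambda>q. \<delta> t q - divergence (\<delta> t) * q) ^^ N) (frame_det B) = 0"
proof -
  have "\<forall>i. \<exists>D. D \<in> div_const \<and> \<phi> D = B i" using surj assms by metis
  then obtain E where E: "\<And>i. E i \<in> div_const" "\<And>i. \<phi> (E i) = B i" by metis
  have "\<forall>i. \<exists>m. vf_below m (E i)" using ex_vf_below by blast
  then obtain m where m: "\<And>i. vf_below (m i) (E i)" by metis
  from frame_det_nilpotent [of E m, OF E(1) m refl, of t] show ?thesis unfolding E(2) by (rule exI)
qed

text \<open>The coordinate frame has determinant 1, an eigenvector of \<open>?T\<close> with
  eigenvalue \<open>- c\<close>; nilpotency on it forces \<open>c = 0\<close>.\<close>

lemma divergence_\<delta>: "divergence (\<delta> t) = 0"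
proof -
  obtain c where c: "divergence (\<delta> t) = Const c" using \<delta>_mem by (auto simp: div_const_def)
  let ?T = "\<lambda>q. \<delta> t q - Const c * q"
  have "(?T ^^ N) 1 = Const ((- c) ^ N)" for N
    by (induction N) (simp_all add: \<delta>D Const_mult Const_minus)
  moreover obtain N where "(?T ^^ N) (frame_det partial) = 0"
    using ex_frame_det_nilpotent [of partial t, OF partial_div_const] unfolding c by blast
  ultimately have "c = 0" by (simp add: frame_det_partial)
  with c show ?thesis by simp
qed

lemma \<delta>_locally_nilpotent: "\<exists>N. (\<delta> t ^^ N) p = 0"
proof (induction p rule: mpoly_ring_induct)
  case (Const c)
  show ?case by (rule exI [of _ 1]) (simp add: \<delta>D)
next
  case (Var i)
  \<comment> \<open>Scaling the \<open>i\<close>-th coordinate field by \<open>Var i\<close> gives a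
    field of divergence 1, so the frame stays in the Lie algebra while its determinant becomes
    \<open>Var i\<close>.\<close>
  let ?B = "partial(i := (\<lambda>p :: ('n, 'k) mpoly. Var i * partial i p))"
  have B: "?B j \<in> div_const" for j by (simp add: partial_div_const Var_partial_div_const)
  obtain N where "((\<lambda>q. \<delta> t q - divergence (\<delta> t) * q) ^^ N) (frame_det ?B) = 0"
    using ex_frame_det_nilpotent [of ?B t, OF B] by blast
  moreover have "frame_det ?B = Var i"
    unfolding frame_det_scale by (simp add: frame_det_partial)
  ultimately show ?case by (auto simp: divergence_\<delta>)
next
  case (add p q)
  then obtain a b where ab: "(\<delta> t ^^ a) p = 0" "(\<delta> t ^^ b) q = 0" by blast
  have z: "(\<delta> t ^^ N) 0 = 0" for N by (rule funpow_fixed_point) (rule \<delta>D)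
  have "(\<delta> t ^^ N) (p + q) = (\<delta> t ^^ N) p + (\<delta> t ^^ N) q" for N
    by (induction N) (simp_all add: \<delta>D)
  moreover have "(\<delta> t ^^ (b + a)) p = 0" using ab z by (simp add: funpow_add)
  moreover have "(\<delta> t ^^ (b + a)) q = 0" unfolding add.commute [of b] using ab z by (simp add: funpow_add)
  ultimately show ?case by (intro exI [of _ "b + a"]) simp
next
  case (mult p q)
  then show ?case using derivation_nilpotent_mult [OF \<delta>_deriv] by blast
qed

text \<open>Multiplication by a joint constant \<open>a\<close> of the \<open>\<delta> j\<close> preserves their span, the centralizer of
  the \<open>\<delta> j\<close>; commuting with the images of \<open>x\<^sub>k \<partial>\<^sub>k\<close> forces its matrix \<open>c\<close> to be diagonal.\<close>

lemma \<delta>_kernel: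
  assumes a: "\<And>i. \<delta> i a = 0"
  obtains c where "a = Const c"
proof -
  have "\<exists>c. \<forall>p. a * \<delta> j p = (\<Sum>i\<in>UNIV. Const (c i) * \<delta> i p)" for j
  proof -
    have "divergence (\<lambda>p. a * \<delta> j p) = Const 0"
      by (simp add: divergence_mult [OF \<delta>_deriv] a divergence_\<delta>)
    then have m: "(\<lambda>p. a * \<delta> j p) \<in> div_const"
      using derivations_mult [OF \<delta>_deriv] unfolding div_const_def by blast
    have b: "bracket (\<delta> i) (\<lambda>p. a * \<delta> j p) = (\<lambda>p. 0)" for i
      by (simp add: bracket_def \<delta>D a \<delta>_commute [of i j])
    show ?thesis by (rule \<delta>_centralizer [OF m b]) blast
  qed
  then obtain c where c: "\<And>j p. a * \<delta> j p = (\<Sum>i\<in>UNIV. Const (c j i) * \<delta> i p)" by metis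
  define e where "e k = \<phi> (\<lambda>p. Var k * partial k p)" for k
  have e_deriv: "e k \<in> derivations" for k
    unfolding e_def by (rule deriv [OF Var_partial_div_const])
  have e\<delta>: "e k (\<delta> l p) = \<delta> l (e k p) - (if k = l then \<delta> l p else 0)" for k l p
  proof -
    have "bracket (partial l) (\<lambda>p. Var k * partial k p) = (\<lambda>p. Const (if k = l then 1 else 0) * partial l p)"
      by (auto simp: bracket_def partial_mult partial_Var partial_commute [of l k])
    from arg_cong [OF this, of \<phi>] have "bracket (\<delta> l) (e k) = (\<lambda>p. Const (if k = l then 1 else 0) * \<delta> l p)"
      unfolding bracket_\<delta> [OF Var_partial_div_const, symmetric] scale [OF partial_div_const] e_def \<delta>_def .
    then have "\<delta> l (e k p) - e k (\<delta> l p) = Const (if k = l then 1 else 0) * \<delta> l p"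
      unfolding bracket_def by metis
    then show ?thesis by (auto simp: algebra_simps split: if_splits)
  qed
  \<comment> \<open>This comes from applying \<open>e k\<close> to both sides of \<open>c\<close>
    and using \<open>e\<delta>\<close> to move it past each \<open>\<delta> i\<close>; the terms in
    \<open>\<delta> i (e k p)\<close> cancel by \<open>c\<close> again.\<close>
  have main: "e k a * \<delta> j p - (if k = j then a * \<delta> j p else 0) = - Const (c j k) * \<delta> k p" for j k p
  proof -
    have "e k (a * \<delta> j p) = e k a * \<delta> j p + a * \<delta> j (e k p) - (if k = j then a * \<delta> j p else 0)"
      by (simp add: derivationD(2) [OF e_deriv] e\<delta> right_diff_distrib)
    moreover have "e k (a * \<delta> j p) =
        (\<Sum>i\<in>UNIV. Const (c j i) * \<delta> i (e k p)) - (\<Sum>i\<in>UNIV. if k = i then Const (c j i) * \<delta> i p else 0)"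
      unfolding c sum_subtractf [symmetric]
      by (simp add: derivationD(8,3) [OF e_deriv] e\<delta> right_diff_distrib if_distrib cong: if_cong)
    ultimately show ?thesis by (simp add: c [of _ "e k p", symmetric] algebra_simps)
  qed
  have eka: "e k a = a - Const (c k k)" for k
  proof -
    have "(e k a - a + Const (c k k)) * \<delta> k p = 0" for p
      using main [of k k p] by (simp add: algebra_simps)
    from \<delta>_cancel [OF this] show ?thesis by (simp add: algebra_simps)
  qed
  fix j :: 'n
  have off: "c j k = 0" if "k \<noteq> j" for k
  proof -
    \<comment> \<open>This relation combines \<open>main\<close>, \<open>eka\<close> and the
      expansion of \<open>a * \<delta> j p\<close>. Its coefficient at \<open>k\<close> is twice
      \<open>c j k\<close>, which must vanish in characteristic zero.\<close>
    have "(\<Sum>i\<in>UNIV. Const (c j i - (if i = j then c k k else 0) + (if i = k then c j k else 0)) * \<delta> i p) = 0" for p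
    proof -
      have "(\<Sum>i\<in>UNIV. Const (c j i - (if i = j then c k k else 0) + (if i = k then c j k else 0)) * \<delta> i p) =
          (\<Sum>i\<in>UNIV. Const (c j i) * \<delta> i p - (if i = j then Const (c k k) * \<delta> i p else 0) +
            (if i = k then Const (c j k) * \<delta> i p else 0))"
        by (intro sum.cong refl)
          (simp add: Const_add Const_minus diff_conv_add_uminus distrib_right del: add_uminus_conv_diff)
      also have "\<dots> = a * \<delta> j p - Const (c k k) * \<delta> j p + Const (c j k) * \<delta> k p"
        by (simp add: sum.distrib sum_subtractf c)
      also have "\<dots> = 0"
        using main [of k j p] that by (simp add: eka algebra_simps)
      finally show ?thesis .
    qed
    from \<delta>_independent_Const [OF this, of k] that show ?thesis by simp
  qed
  have "(a - Const (c j j)) * \<delta> j p = 0" for p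
  proof -
    have "a * \<delta> j p = (\<Sum>i\<in>UNIV. if i = j then Const (c j i) * \<delta> i p else 0)"
      unfolding c by (intro sum.cong) (auto simp: off)
    then show ?thesis by (simp add: algebra_simps)
  qed
  from \<delta>_cancel [OF this] that show thesis by simp
qed

text \<open>The relations with polynomial coefficients are stable under applying
  \<open>\<delta> k\<close> to every coefficient, and these operators commute and are locally
  nilpotent. A nontrivial relation would thus yield one with coefficients in the joint kernel, that
  is, with constant coefficients.\<close>

lemma \<delta>_independent:
  assumes "\<And>p. (\<Sum>i\<in>UNIV. a i * \<delta> i p) = 0"
  shows "a j = 0"
proof (rule ccontr)
  assume "a j \<noteq> 0"
  let ?T = "\<lambda>k (a :: 'n \<Rightarrow> _) i. \<delta> k (a i)"
  let ?R = "{a. \<forall>p. (\<Sum>i\<in>UNIV. a i * \<delta> i p) = 0}"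
  have pw: "(?T k ^^ N) b = (\<lambda>i. (\<delta> k ^^ N) (b i))" for k N b
    by (induction N) auto
  have "\<exists>w\<in>?R. w \<noteq> (\<lambda>i. 0) \<and> (\<forall>k\<in>UNIV. ?T k w = (\<lambda>i. 0))"
  proof (rule joint_kernel_nontrivial)
    fix k and b :: "'n \<Rightarrow> ('n, 'k) mpoly" assume b: "b \<in> ?R"
    have "(\<Sum>i\<in>UNIV. \<delta> k (b i) * \<delta> i p) = 0" for p
    proof -
      have "(\<Sum>i\<in>UNIV. b i * \<delta> i p) = 0" "(\<Sum>i\<in>UNIV. b i * \<delta> i (\<delta> k p)) = 0" using b by auto
      from arg_cong [OF this(1), of "\<delta> k"] this(2) show ?thesis
        by (simp add: \<delta>D sum.distrib \<delta>_commute [of k])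
    qed
    then show "?T k b \<in> ?R" by simp
    have "\<forall>i. \<exists>N. (\<delta> k ^^ N) (b i) = 0" using \<delta>_locally_nilpotent by blast
    then obtain f where f: "\<And>i. (\<delta> k ^^ f i) (b i) = 0" by metis
    \<comment> \<open>The sum of the individual exponents is a common exponent for all
      coefficients.\<close>
    have "(\<delta> k ^^ sum f UNIV) (b i) = 0" for i
    proof -
      have "sum f UNIV = sum f (UNIV - {i}) + f i" by (simp add: sum.remove [of _ i])
      then show ?thesis by (simp add: funpow_add f funpow_fixed_point \<delta>D)
    qed
    then show "\<exists>N. (?T k ^^ N) b = (\<lambda>i. 0)" unfolding pw by blast
  next
    show "a \<in> ?R" using assms by simp
    show "a \<noteq> (\<lambda>i. 0)" using \<open>a j \<noteq> 0\<close> by auto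
  qed (simp_all add: \<delta>D \<delta>_commute)
  then obtain w where w: "w \<in> ?R" "w \<noteq> (\<lambda>i. 0)" "\<forall>k\<in>UNIV. ?T k w = (\<lambda>i. 0)"
    by (elim bexE conjE)
  then have w3: "\<delta> k (w i) = 0" for k i using fun_cong [of "?T k w" "\<lambda>i. 0"] by simp
  have "\<exists>c. w i = Const c" for i by (rule \<delta>_kernel [OF w3]) blast
  then obtain c where c: "\<And>i. w i = Const (c i)" by metis
  with w(1) have "c i = 0" for i by (intro \<delta>_independent_Const) simp
  with c w(2) show False by auto
qed

end

context div_const_aut
begin

text \<open>A frame of least total degree whose image is nondegenerate has constant determinant. Since the
  \<open>\<delta> i\<close> are independent, its members can be exchanged for the coordinate fields one at a time.\<close>

lemma frame_det_\<delta>: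
  obtains c where "frame_det \<delta> = Const c" "c \<noteq> 0"
proof -
  define P where "P N E m \<longleftrightarrow> (\<forall>i. E i \<in> div_const) \<and> (\<forall>i. vf_below (m i) (E i)) \<and>
    sum m UNIV \<le> N \<and> frame_det (\<lambda>i. \<phi> (E i)) \<noteq> 0" for N E and m :: "'n \<Rightarrow> nat"
  have "\<exists>N E m. P N E m"
  proof -
    have "\<exists>D. D \<in> div_const \<and> \<phi> D = partial i" for i using surj [OF partial_div_const] by blast
    then obtain E where E: "\<And>i. E i \<in> div_const" "\<And>i. \<phi> (E i) = partial i" by metis
    have "\<exists>m. vf_below m (E i)" for i by (rule ex_vf_below)
    then obtain m where m: "\<And>i. vf_below (m i) (E i)" by metis
    have "frame_det (\<lambda>i. \<phi> (E i)) = 1" unfolding E(2) using frame_det_partial by simp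
    then have "P (sum m UNIV) E m" using E m unfolding P_def by simp
    then show ?thesis by blast
  qed
  then obtain N where N: "\<exists>E m. P N E m" and least: "\<And>M. M < N \<Longrightarrow> \<not> (\<exists>E m. P M E m)"
    using exists_least_iff [of "\<lambda>N. \<exists>E m. P N E m"] by blast
  have less: "frame_det (\<lambda>i. \<phi> (E i)) = 0"
    if "\<And>i. E i \<in> div_const" "\<And>i. vf_below (m i) (E i)" "sum m UNIV < N" for E m
    using least [OF that(3)] that(1,2) unfolding P_def by blast
  \<comment> \<open>Bounds of at least 1 matter below: replacing a member by a coordinate field, of
    bound 1, cannot raise the total.\<close>
  have pos: "m k > 0" if "P N E m" for E m k
  proof (rule ccontr)
    assume "\<not> m k > 0"
    then have "E k = (\<lambda>p. 0)"
      using that vf_below_0 [of "E k"] div_const_derivation [of "E k"] unfolding P_def by (metis gr0I)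
    then have "frame_det (\<lambda>i. \<phi> (E i)) = 0" using zero by (intro frame_det_zero [of _ k]) simp
    with that show False unfolding P_def by simp
  qed
  \<comment> \<open>By minimality of \<open>N\<close> every summand of the Lie derivative formula
    vanishes, so the determinant lies in the joint kernel of the \<open>\<delta> t\<close>.\<close>
  have const: "\<exists>c. frame_det (\<lambda>i. \<phi> (E i)) = Const c" if E: "P N E m" for E m
  proof -
    have "\<delta> t (frame_det (\<lambda>i. \<phi> (E i))) = 0" for t
    proof -
      let ?E = "\<lambda>k. E(k := bracket (partial t) (E k))"
      have upd: "(\<lambda>i. \<phi> (E i))(k := bracket (\<delta> t) (\<phi> (E k))) = (\<lambda>i. \<phi> (?E k i))" for k
        using bracket_\<delta> E unfolding P_def by auto
      have "frame_det (\<lambda>i. \<phi> (?E k i)) = 0" for k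
      proof (rule less)
        show "?E k i \<in> div_const" for i
          using E unfolding P_def by (simp add: div_const_bracket partial_div_const)
        have "vf_below (m k - 1) (bracket (partial t) (E k))"
          using E vf_below_bracket_partial div_const_derivation unfolding P_def by blast
        then show "vf_below ((m(k := m k - 1)) i) (?E k i)" for i
          using E unfolding P_def by simp
        show "sum (m(k := m k - 1)) UNIV < N"
          using sum_fun_upd [of m k "m k - 1"] pos [OF E, of k] E unfolding P_def by auto
      qed
      then show ?thesis
        using derivation_frame_det [OF \<delta>_deriv [of t], of "\<lambda>i. \<phi> (E i)"] deriv E
        unfolding P_def upd by (simp add: divergence_\<delta>)
    qed
    then show ?thesis using \<delta>_kernel by blast
  qed
  have "\<exists>E m. P N E m \<and> (\<forall>s\<in>S. E s = partial s)" for S :: "'n set"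
    using finite [of S]
  proof induction
    case empty
    show ?case using N by blast
  next
    case (insert t S)
    from insert.IH obtain E m where E: "P N E m" and S: "\<forall>s\<in>S. E s = partial s" by blast
    let ?F = "\<lambda>i. \<phi> (E i)"
    obtain c where c: "frame_det ?F = Const c" using const [OF E] by blast
    have F: "?F i \<in> derivations" for i using E deriv unfolding P_def by blast
    \<comment> \<open>Otherwise the Cramer expansion of \<open>Const c * \<delta> t\<close> would
      involve only the \<open>\<delta> s\<close> with \<open>s\<close> in \<open>S\<close>, against
      independence because \<open>t\<close> is not in \<open>S\<close>.\<close>
    have "\<exists>l. l \<notin> S \<and> frame_det (?F(l := \<delta> t)) \<noteq> 0"
    proof (rule ccontr)
      assume "\<not> ?thesis"
      then have z: "frame_det (?F(l := \<delta> t)) = 0" if "l \<notin> S" for l using that by blast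
      have "(\<Sum>i\<in>UNIV. ((if i = t then Const c else 0) - (if i \<in> S then frame_det (?F(i := \<delta> t)) else 0)) * \<delta> i p) = 0"
        (is "(\<Sum>i\<in>UNIV. ?a i * \<delta> i p) = 0") for p
      proof -
        have "Const c * \<delta> t p = (\<Sum>i\<in>UNIV. frame_det (?F(i := \<delta> t)) * ?F i p)"
          using frame_expansion [of "\<delta> t" ?F p, OF \<delta>_deriv F] unfolding c .
        also have "\<dots> = (\<Sum>i\<in>UNIV. (if i \<in> S then frame_det (?F(i := \<delta> t)) else 0) * \<delta> i p)"
          by (intro sum.cong) (auto simp: z S simp flip: \<delta>_def)
        also have "Const c * \<delta> t p = (\<Sum>i\<in>UNIV. (if i = t then Const c else 0) * \<delta> i p)"
          by (simp add: if_distrib [where f = "\<lambda>x. x * _"] cong: if_cong)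
        finally show ?thesis by (simp add: left_diff_distrib sum_subtractf)
      qed
      from \<delta>_independent [of ?a, OF this, of t] insert.hyps have "c = 0" by simp
      with c E show False unfolding P_def by simp
    qed
    then obtain l where l: "l \<notin> S" "frame_det (?F(l := \<delta> t)) \<noteq> 0" by blast
    let ?E = "E(l := partial t)" and ?m = "m(l := 1)"
    have E': "P N ?E ?m"
    proof -
      have "?F(l := \<delta> t) = (\<lambda>i. \<phi> (?E i))" by (auto simp: \<delta>_def)
      with l(2) E sum_fun_upd [of m l 1] pos [OF E, of l] show ?thesis
        unfolding P_def by (simp add: partial_div_const vf_below_1_partial [unfolded One_nat_def])
    qed
    show ?case
    proof (cases "l = t")
      case True
      with S have "\<forall>s\<in>insert t S. ?E s = partial s" by simp
      with E' show ?thesis by blast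
    next
      case False
      \<comment> \<open>The exchanged position \<open>l\<close> need not be \<open>t\<close>.
        Swapping the two positions changes only the sign of the determinant and keeps the total
        bound.\<close>
      let ?G = "\<lambda>i. \<phi> (?E i)" and ?E2 = "?E(t := ?E l, l := ?E t)" and ?m2 = "?m(t := ?m l, l := ?m t)"
      have "(\<lambda>i. \<phi> (?E2 i)) = ?G(t := ?G l, l := ?G t)" using False by auto
      then have "frame_det (\<lambda>i. \<phi> (?E2 i)) = - frame_det ?G"
        using frame_det_swap [of t l ?G] False by simp
      moreover have "sum ?m2 UNIV = sum ?m UNIV"
        using sum_fun_upd [of "?m(t := ?m l)" l "?m t"] sum_fun_upd [of ?m t "?m l"] False by simp
      moreover have "?E2 i \<in> div_const \<and> vf_below (?m2 i) (?E2 i)" for i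
      proof -
        have "?E2 i = ?E j \<and> ?m2 i = ?m j" if "j = (if i = t then l else if i = l then t else i)" for j
          using that False by simp
        moreover have "?E j \<in> div_const \<and> vf_below (?m j) (?E j)" for j
          using E' unfolding P_def by blast
        ultimately show ?thesis by metis
      qed
      ultimately have "P N ?E2 ?m2" using E' unfolding P_def by (simp del: fun_upd_apply)
      moreover have "\<forall>s\<in>insert t S. ?E2 s = partial s" using S l False insert.hyps by auto
      ultimately show ?thesis by blast
    qed
  qed
  from this [of UNIV] obtain E m where E: "P N E m" "\<And>s. E s = partial s" by blast
  have "(\<lambda>i. \<phi> (E i)) = \<delta>" by (simp add: E(2) \<delta>_def fun_eq_iff)
  with const [OF E(1)] E(1) that show thesis unfolding P_def by auto
qed

text \<open>The determinant of the frame \<open>\<delta>\<close> is a nonzero constant, so Cramer's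
  rule may be divided by it. Transporting \<open>bracket_partial_euler\<close> along
  \<open>\<phi>\<close> and comparing coefficients then yields the dual coordinates.\<close>

lemma euler_coordinates:
  obtains y where "\<And>i k. \<delta> i (y k) = (if i = k then 1 else 0)"
    and "\<And>p. \<phi> euler p = (\<Sum>k\<in>UNIV. y k * \<delta> k p)"
proof -
  obtain c where c: "frame_det \<delta> = Const c" "c \<noteq> 0" using frame_det_\<delta> .
  have h: "\<phi> euler \<in> derivations" by (rule deriv [OF euler_div_const])
  define y where "y k = Const (inverse c) * frame_det (\<delta>(k := \<phi> euler))" for k
  have y: "\<phi> euler p = (\<Sum>k\<in>UNIV. y k * \<delta> k p)" for p
  proof -
    have "\<phi> euler p = Const (inverse c) * (frame_det \<delta> * \<phi> euler p)"
      using c by (simp flip: mult.assoc Const_mult)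
    also have "\<dots> = (\<Sum>k\<in>UNIV. y k * \<delta> k p)"
      unfolding frame_expansion [OF h \<delta>_deriv] by (simp add: y_def sum_distrib_left mult.assoc)
    finally show ?thesis .
  qed
  have "\<delta> i (y k) = (if i = k then 1 else 0)" for i k
  proof -
    have "(\<Sum>k\<in>UNIV. (\<delta> i (y k) - (if i = k then 1 else 0)) * \<delta> k p) = 0" for p
    proof -
      have "\<delta> i (\<phi> euler p) - \<phi> euler (\<delta> i p) = \<delta> i p"
        using bracket_\<delta> [OF euler_div_const, of i]
        unfolding bracket_partial_euler \<delta>_def [symmetric] by (simp add: bracket_def fun_eq_iff)
      moreover have "\<delta> i (\<phi> euler p) - \<phi> euler (\<delta> i p) = (\<Sum>k\<in>UNIV. \<delta> i (y k) * \<delta> k p)"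
        by (simp add: y \<delta>D sum.distrib \<delta>_commute [of i])
      moreover have "(\<Sum>k\<in>UNIV. (if i = k then 1 else 0) * \<delta> k p) = \<delta> i p"
        by (simp add: if_distrib [where f = "\<lambda>x. x * _"] cong: if_cong)
      ultimately show ?thesis by (simp add: left_diff_distrib sum_subtractf)
    qed
    from \<delta>_independent [of "\<lambda>k. \<delta> i (y k) - (if i = k then 1 else 0)", OF this, of k]
    show ?thesis by simp
  qed
  with y that show thesis by blast
qed

end

section \<open>Substitution homomorphisms\<close>

definition poly_subst :: "('n::finite \<Rightarrow> ('m, 'k::field_char_0) mpoly) \<Rightarrow> ('n, 'k) mpoly \<Rightarrow> ('m, 'k) mpoly"
  where "poly_subst y p = (\<Sum>m\<in>Poly_Mapping.keys p.
    Const (Poly_Mapping.lookup p m) * (\<Prod>i\<in>UNIV. y i ^ Poly_Mapping.lookup m i))"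

lemma poly_subst_superset:
  assumes "finite A" "Poly_Mapping.keys p \<subseteq> A"
  shows "poly_subst y p = (\<Sum>m\<in>A. Const (Poly_Mapping.lookup p m) * (\<Prod>i\<in>UNIV. y i ^ Poly_Mapping.lookup m i))"
  unfolding poly_subst_def using assms
  by (intro sum.mono_neutral_left) (auto simp: in_keys_iff)

lemma poly_subst_add: "poly_subst y (p + q) = poly_subst y p + poly_subst y q"
proof -
  let ?A = "Poly_Mapping.keys p \<union> Poly_Mapping.keys q"
  have A: "finite ?A" by simp
  show ?thesis
    unfolding poly_subst_superset [OF A Poly_Mapping.keys_add]
      poly_subst_superset [OF A Un_upper1] poly_subst_superset [OF A Un_upper2]
    by (simp add: lookup_add Const_add distrib_right sum.distrib)
qed

lemma poly_subst_single:
  "poly_subst y (Poly_Mapping.single m c) = Const c * (\<Prod>i\<in>UNIV. y i ^ Poly_Mapping.lookup m i)"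
  by (subst poly_subst_superset [of "{m}"]) auto

lemma poly_subst_Const [simp]: "poly_subst y (Const c) = Const c"
  by (simp add: Const_def poly_subst_single)

lemma poly_subst_0 [simp]: "poly_subst y 0 = 0" and poly_subst_1 [simp]: "poly_subst y 1 = 1"
  using poly_subst_Const [of y 0] poly_subst_Const [of y 1] by simp_all

lemma poly_subst_Var [simp]: "poly_subst y (Var i) = y i"
proof -
  have "(\<Prod>j\<in>UNIV. y j ^ Poly_Mapping.lookup (Poly_Mapping.single i 1) j) = (\<Prod>j\<in>UNIV. if j = i then y j else 1)"
    by (intro prod.cong) (auto simp: lookup_single when_def)
  then show ?thesis by (simp add: Var_def poly_subst_single)
qed

lemma poly_subst_mult: "poly_subst y (p * q) = poly_subst y p * poly_subst y q"
proof (induction p rule: mpoly_induct)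
  case (add p m c)
  have "poly_subst y (Poly_Mapping.single m c * q) = poly_subst y (Poly_Mapping.single m c) * poly_subst y q"
  proof (induction q rule: mpoly_induct)
    case (add q k d)
    have "poly_subst y (Poly_Mapping.single m c * Poly_Mapping.single k d) =
        poly_subst y (Poly_Mapping.single m c) * poly_subst y (Poly_Mapping.single k d)"
      by (simp add: mult_single poly_subst_single lookup_add power_add prod.distrib Const_mult mult_ac)
    with add show ?case by (simp add: distrib_left poly_subst_add)
  qed simp
  with add show ?case by (simp add: distrib_right poly_subst_add)
qed simp

text \<open>Both sides obey the same Leibniz rule over the homomorphism \<open>poly_subst y\<close>,
  so agreement on constants and variables suffices.\<close>

lemma poly_subst_derivation:
  assumes D: "\<And>i. D i \<in> derivations" and y: "\<And>i k. D i (y k) = (if i = k then 1 else 0)"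
  shows "D i (poly_subst y p) = poly_subst y (partial i p)"
proof (induction p rule: mpoly_ring_induct)
  case (Var k)
  show ?case by (simp add: y partial_Var)
qed (simp_all add: derivationD [OF D] poly_subst_add poly_subst_mult partial_add partial_mult)

lemma poly_subst_diff: "poly_subst y (p - q) = poly_subst y p - poly_subst y q"
  by (metis add_diff_cancel_right' diff_add_cancel poly_subst_add)

context div_const_aut
begin

text \<open>The kernel is stable under all \<open>partial i\<close>, so if nonzero it would contain
  a nonzero constant, which is fixed by the substitution. For surjectivity, polynomials are reduced
  to the joint kernel of the \<open>\<delta> i\<close> one direction at a time by subtracting Taylor
  terms.\<close>

lemma poly_subst_alg_aut:
  assumes y: "\<And>i k. \<delta> i (y k) = (if i = k then 1 else 0)"
  shows "poly_subst y \<in> alg_auts"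
proof -
  note ys = poly_subst_derivation [of \<delta> y, OF \<delta>_deriv y]
  have "p = 0" if "poly_subst y p = 0" for p
  proof (rule ccontr)
    assume "p \<noteq> 0"
    have "\<exists>w\<in>{p. poly_subst y p = 0}. w \<noteq> 0 \<and> (\<forall>i\<in>UNIV. partial i w = 0)"
    proof (rule joint_kernel_nontrivial)
      show "partial i v \<in> {p. poly_subst y p = 0}" if "v \<in> {p. poly_subst y p = 0}" for i v
        using ys [of i v] that by (simp add: \<delta>D)
      show "p \<in> {p. poly_subst y p = 0}" "p \<noteq> 0" using that \<open>p \<noteq> 0\<close> by simp_all
    qed (simp_all add: partial_commute partial_locally_nilpotent)
    then obtain w where w: "poly_subst y w = 0" "w \<noteq> 0" "\<And>i. partial i w = 0" by blast
    then obtain c where "w = Const c" by (metis Const_of_partials_zero)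
    with w show False by simp
  qed
  then have inj: "inj (poly_subst y)"
    by (intro injI) (metis poly_subst_diff right_minus_eq)
  have "p \<in> range (poly_subst y)" if "\<forall>i. i \<notin> S \<longrightarrow> \<delta> i p = 0" for S :: "'n set" and p
    using finite [of S] that
  proof (induction S arbitrary: p)
    case empty
    then obtain c where "p = Const c" using \<delta>_kernel by blast
    then show ?case by (metis poly_subst_Const rangeI)
  next
    case (insert i S)
    obtain N where "(\<delta> i ^^ N) p = 0" using \<delta>_locally_nilpotent by blast
    then show ?case using insert.prems
    proof (induction N arbitrary: p)
      case 0
      then show ?case by (metis funpow_0 poly_subst_0 rangeI)
    next
      case (Suc M)
      \<comment> \<open>This top iterate is killed by \<open>\<delta> i\<close> as well, so the
        outer induction puts it in the range.\<close>
      define c where "c = (\<delta> i ^^ M) p"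
      have pow: "\<delta> j ((\<delta> i ^^ M) q) = (\<delta> i ^^ M) (\<delta> j q)" for j q
        by (induction M) (simp_all add: \<delta>_commute [of j])
      have ci: "\<delta> i c = 0" using Suc.prems(1) by (simp add: c_def)
      have cj: "\<delta> j c = 0" if "j \<notin> insert i S" for j
        using Suc.prems(2) that unfolding c_def pow by (simp add: funpow_fixed_point \<delta>D)
      have "\<forall>j. j \<notin> S \<longrightarrow> \<delta> j c = 0" using ci cj by (metis insert_iff)
      then obtain q where q: "c = poly_subst y q" using insert.IH by blast
      have lin: "(\<delta> i ^^ L) (Const d * r) = Const d * (\<delta> i ^^ L) r" for L d r
        by (induction L) (simp_all add: \<delta>D)
      have Dpow: "\<delta> i (y i ^ Suc L) = Const (of_nat (Suc L)) * y i ^ L" for L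
        unfolding of_nat_mpoly [symmetric] by (induction L) (simp_all add: \<delta>D y algebra_simps)
      have fact: "(\<delta> i ^^ L) (y i ^ L * c) = Const (fact L) * c" for L
      proof (induction L)
        case (Suc L)
        have "\<delta> i (y i ^ Suc L * c) = Const (of_nat (Suc L)) * (y i ^ L * c)"
          by (simp only: \<delta>D(2) [of i "y i ^ Suc L"] Dpow ci) (simp add: mult.assoc)
        then have "(\<delta> i ^^ Suc L) (y i ^ Suc L * c) = Const (of_nat (Suc L)) * (\<delta> i ^^ L) (y i ^ L * c)"
          by (simp only: funpow_Suc_right o_apply lin)
        then show ?case by (simp add: Suc Const_mult [symmetric] mult.assoc [symmetric] del: of_nat_Suc)
      qed simp
      \<comment> \<open>The leading Taylor term in direction \<open>y i\<close>: it has the same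
        iterate of order \<open>M\<close> as \<open>p\<close>, so the difference falls under the
        inner induction.\<close>
      let ?r = "Const (inverse (fact M)) * (y i ^ M * c)"
      have "p - ?r \<in> range (poly_subst y)"
      proof (rule Suc.IH)
        have sub: "(\<delta> i ^^ M) (u - v) = (\<delta> i ^^ M) u - (\<delta> i ^^ M) v" for u v
          by (induction M) (simp_all add: \<delta>D)
        show "(\<delta> i ^^ M) (p - ?r) = 0"
          unfolding sub lin fact by (simp add: c_def [symmetric] Const_mult [symmetric] mult.assoc [symmetric])
        have "\<delta> j (y i ^ L) = 0" if "j \<noteq> i" for j L
          using that by (induction L) (simp_all add: \<delta>D y)
        then show "\<forall>j. j \<notin> insert i S \<longrightarrow> \<delta> j (p - ?r) = 0"
          using Suc.prems(2) cj by (simp add: \<delta>D)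
      qed
      then obtain u where u: "p - ?r = poly_subst y u" by blast
      have pw: "poly_subst y (Var i ^ L) = y i ^ L" for L
        by (induction L) (simp_all add: poly_subst_mult)
      have "p = poly_subst y (u + Const (inverse (fact M)) * (Var i ^ M * q))"
        using u by (simp add: poly_subst_add poly_subst_mult pw q algebra_simps)
      then show ?case by blast
    qed
  qed
  from this [of UNIV] have "surj (poly_subst y)" by blast
  with inj show ?thesis
    by (simp add: alg_auts_def bij_def poly_subst_add poly_subst_mult)
qed

end

section \<open>Conjugation by algebra automorphisms\<close>

text \<open>Unlike \<open>conjugation\<close>, this is not cut off outside \<open>div_const\<close>,
  so it can be studied on all derivations before stability of \<open>div_const\<close> is
  known.\<close>

definition pushforward ::
    "(('n, 'k::field_char_0) mpoly \<Rightarrow> ('n, 'k) mpoly) \<Rightarrow> (('n, 'k) mpoly \<Rightarrow> ('n, 'k) mpoly)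
      \<Rightarrow> ('n, 'k) mpoly \<Rightarrow> ('n, 'k) mpoly"
  where "pushforward \<sigma> D = \<sigma> \<circ> D \<circ> inv_into UNIV \<sigma>"

lemma alg_autsD:
  assumes "\<sigma> \<in> alg_auts"
  shows "\<sigma> (p + q) = \<sigma> p + \<sigma> q" "\<sigma> (p * q) = \<sigma> p * \<sigma> q" "\<sigma> (Const c) = Const c"
    "\<sigma> 0 = 0" "\<sigma> 1 = 1" "\<sigma> (p - q) = \<sigma> p - \<sigma> q" "\<sigma> (sum f A) = (\<Sum>a\<in>A. \<sigma> (f a))"
    "inv_into UNIV \<sigma> (\<sigma> p) = p" "\<sigma> (inv_into UNIV \<sigma> p) = p" "bij \<sigma>"
proof -
  show a: "\<sigma> (p + q) = \<sigma> p + \<sigma> q" for p q using assms by (simp add: alg_auts_def)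
  show "\<sigma> (p * q) = \<sigma> p * \<sigma> q" using assms by (simp add: alg_auts_def)
  show c: "\<sigma> (Const c) = Const c" for c using assms by (simp add: alg_auts_def)
  show z: "\<sigma> 0 = 0" using c [of 0] by simp
  show "\<sigma> 1 = 1" using c [of 1] by simp
  show "\<sigma> (p - q) = \<sigma> p - \<sigma> q" by (metis a add_diff_cancel_right' diff_add_cancel)
  show "\<sigma> (sum f A) = (\<Sum>a\<in>A. \<sigma> (f a))"
    by (induction A rule: infinite_finite_induct) (auto simp: a z)
  show b: "bij \<sigma>" using assms by (simp add: alg_auts_def)
  show "inv_into UNIV \<sigma> (\<sigma> p) = p" "\<sigma> (inv_into UNIV \<sigma> p) = p"
    using b by (simp_all add: bij_is_inj bij_is_surj surj_f_inv_f)
qed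

lemma pushforward_apply: "\<sigma> \<in> alg_auts \<Longrightarrow> pushforward \<sigma> D (\<sigma> p) = \<sigma> (D p)"
  by (simp add: pushforward_def alg_autsD(8))

lemma pushforward_eqI:
  assumes \<sigma>: "\<sigma> \<in> alg_auts" and "\<And>p. E (\<sigma> p) = \<sigma> (D p)"
  shows "pushforward \<sigma> D = E"
  unfolding pushforward_def using assms(2) [of "inv_into UNIV \<sigma> _"] by (simp add: fun_eq_iff alg_autsD(9) [OF \<sigma>])

lemma inv_alg_auts:
  assumes "\<sigma> \<in> alg_auts"
  shows "inv_into UNIV \<sigma> \<in> alg_auts"
proof -
  note s = alg_autsD [OF assms]
  let ?\<tau> = "inv_into UNIV \<sigma>"
  have "?\<tau> (p + q) = ?\<tau> p + ?\<tau> q" for p q using s(8) [of "?\<tau> p + ?\<tau> q"] by (simp add: s(1,9))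
  moreover have "?\<tau> (p * q) = ?\<tau> p * ?\<tau> q" for p q using s(8) [of "?\<tau> p * ?\<tau> q"] by (simp add: s(2,9))
  moreover have "?\<tau> (Const c) = Const c" for c using s(8) [of "Const c"] by (simp add: s(3))
  ultimately show ?thesis using bij_imp_bij_inv [OF s(10)] by (simp add: alg_auts_def)
qed

lemma pushforward_inv:
  assumes "\<sigma> \<in> alg_auts"
  shows "pushforward \<sigma> (pushforward (inv_into UNIV \<sigma>) D) = D"
    and "pushforward (inv_into UNIV \<sigma>) (pushforward \<sigma> D) = D"
  by (simp_all add: pushforward_def fun_eq_iff inv_inv_eq alg_autsD [OF assms])

lemma pushforward_derivation:
  assumes \<sigma>: "\<sigma> \<in> alg_auts" and D: "D \<in> derivations"
  shows "pushforward \<sigma> D \<in> derivations"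
proof (rule derivationI)
  note s = alg_autsD [OF \<sigma>] and i = alg_autsD [OF inv_alg_auts [OF \<sigma>]]
  show "pushforward \<sigma> D (p + q) = pushforward \<sigma> D p + pushforward \<sigma> D q" for p q
    by (simp add: pushforward_def i(1) s(1) derivationD(1) [OF D])
  show "pushforward \<sigma> D (Const c * p) = Const c * pushforward \<sigma> D p" for c p
    by (simp add: pushforward_def i(2,3) s(2,3) derivationD(3) [OF D])
  show "pushforward \<sigma> D (p * q) = pushforward \<sigma> D p * q + p * pushforward \<sigma> D q" for p q
    by (simp add: pushforward_def i(2) s(1,2,9) derivationD(2) [OF D])
qed

lemma pushforward_bracket:
  assumes "\<sigma> \<in> alg_auts"
  shows "pushforward \<sigma> (bracket D E) = bracket (pushforward \<sigma> D) (pushforward \<sigma> E)"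
  by (simp add: pushforward_def bracket_def fun_eq_iff alg_autsD(6,8) [OF assms])

lemma frame_det_combination:
  "frame_det (E(k := (\<lambda>p. \<Sum>l\<in>UNIV. a l * E l p))) = a k * frame_det E"
proof -
  let ?M = "\<chi> i j. E i (Var j)"
  have e: "(\<chi> j. \<Sum>l\<in>UNIV. a l * E l (Var j)) = (\<Sum>l\<in>UNIV. a l *s ?M $ l)"
    by (simp add: vec_eq_iff)
  show ?thesis unfolding frame_det_upd e det_row_combination by (simp add: frame_det_def)
qed

text \<open>By the chain rule \<open>P\<close> the Jacobian matrix of \<open>\<sigma>\<close> times
  the matrix of this frame is the identity. The determinant is therefore a unit, hence a nonzero
  constant.\<close>

lemma frame_det_pushforward_partial:
  fixes \<sigma> :: "('n::finite, 'k::field_char_0) mpoly \<Rightarrow> ('n, 'k) mpoly"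
  assumes \<sigma>: "\<sigma> \<in> alg_auts"
  obtains c where "frame_det (\<lambda>i. pushforward \<sigma> (partial i)) = Const c" "c \<noteq> 0"
proof -
  let ?d = "\<lambda>i. pushforward \<sigma> (partial i)" and ?\<tau> = "inv_into UNIV \<sigma>"
  have d: "?d i \<in> derivations" for i by (rule pushforward_derivation [OF \<sigma> partial_derivation])
  have P: "partial i p = (\<Sum>k\<in>UNIV. partial i (\<sigma> (Var k)) * ?d k p)" for i :: 'n and p
  proof -
    let ?E = "pushforward ?\<tau> (partial i)"
    have "?E \<in> derivations" by (rule pushforward_derivation [OF inv_alg_auts [OF \<sigma>] partial_derivation])
    then have "?E q = (\<Sum>k\<in>UNIV. ?E (Var k) * partial k q)" for q
      by (rule fun_cong [OF derivation_expansion])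
    from this [of "?\<tau> p"] have "\<sigma> (?E (?\<tau> p)) = (\<Sum>k\<in>UNIV. \<sigma> (?E (Var k)) * \<sigma> (partial k (?\<tau> p)))"
      by (simp add: alg_autsD(7,2) [OF \<sigma>])
    then show ?thesis
      by (simp add: pushforward_def inv_inv_eq alg_autsD(8-10) [OF \<sigma>])
  qed
  have "(\<chi> i k. partial i (\<sigma> (Var k))) ** (\<chi> k j. ?d k (Var j)) = (\<chi> i j. partial i (Var j))"
    by (simp add: matrix_matrix_mult_def vec_eq_iff flip: P)
  from arg_cong [OF this, of det]
  have "det (\<chi> i k. partial i (\<sigma> (Var k))) * frame_det ?d = frame_det partial"
    unfolding det_mul frame_det_def .
  then have "frame_det ?d * det (\<chi> i k. partial i (\<sigma> (Var k))) = 1"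
    by (simp add: frame_det_partial mult.commute)
  from mpoly_unit_Const [OF this] that show thesis by blast
qed

text \<open>The Lie derivative formula is applied to the conjugated coordinate frame, whose
  determinant is constant. The brackets contribute the negative of
  \<open>\<sigma> (divergence D)\<close>, so the conjugated field has the same divergence.\<close>

lemma pushforward_div_const:
  fixes \<sigma> :: "('n::finite, 'k::field_char_0) mpoly \<Rightarrow> ('n, 'k) mpoly"
  assumes \<sigma>: "\<sigma> \<in> alg_auts" and D: "D \<in> div_const"
  shows "pushforward \<sigma> D \<in> div_const"
proof -
  let ?d = "\<lambda>i. pushforward \<sigma> (partial i)" and ?D = "pushforward \<sigma> D"
  have D': "D \<in> derivations" by (rule div_const_derivation [OF D])
  note s = alg_autsD [OF \<sigma>]
  have pD: "?D \<in> derivations" by (rule pushforward_derivation [OF \<sigma> D'])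
  obtain c where c: "frame_det ?d = Const c" "c \<noteq> 0" using frame_det_pushforward_partial [OF \<sigma>] .
  obtain v where v: "divergence D = Const v" using D by (auto simp: div_const_def)
  have b: "bracket ?D (?d k) = (\<lambda>p. \<Sum>l\<in>UNIV. - \<sigma> (partial k (D (Var l))) * ?d l p)" for k
  proof -
    have "bracket D (partial k) p = - (\<Sum>l\<in>UNIV. partial k (D (Var l)) * partial l p)" for p
      by (simp add: bracket_def partial_derivation_apply [OF D', of k p])
    then show ?thesis
      unfolding pushforward_bracket [OF \<sigma>, symmetric]
      by (simp add: pushforward_def fun_eq_iff s(2,7) sum_negf [symmetric] alg_autsD(6) [OF \<sigma>, of 0, simplified s(4) diff_0])
  qed
  have "?D (frame_det ?d) = divergence ?D * frame_det ?d +
      (\<Sum>k\<in>UNIV. frame_det (?d(k := bracket ?D (?d k))))"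
    by (rule derivation_frame_det [OF pD]) (rule pushforward_derivation [OF \<sigma> partial_derivation])
  also have "\<dots> = (divergence ?D - \<sigma> (divergence D)) * frame_det ?d"
    unfolding b frame_det_combination
    by (simp add: divergence_def s(7) sum_negf left_diff_distrib sum_distrib_right)
  finally have "(divergence ?D - Const v) * Const c = 0"
    by (simp add: c v s(3) derivationD(5) [OF pD])
  then have "divergence ?D = Const v"
    using mpoly_no_zero_divisors [of "divergence ?D - Const v" "Const c"] c(2) by auto
  then show ?thesis by (rule div_constI [OF pD])
qed

text \<open>Division by zero sends the constant term to \<open>0\<close>.\<close>

definition euler_inv :: "('n::finite, 'k::field_char_0) mpoly \<Rightarrow> ('n, 'k) mpoly"
  where "euler_inv p = Poly_Mapping.mapp (\<lambda>m c. c / of_nat (mdegree m)) p"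

lemma lookup_euler_inv:
  "Poly_Mapping.lookup (euler_inv p) m = Poly_Mapping.lookup p m / of_nat (mdegree m)"
  by (simp add: euler_inv_def lookup_mapp when_def in_keys_iff)

lemma lookup_euler: "Poly_Mapping.lookup (euler p) m = of_nat (mdegree m) * Poly_Mapping.lookup p m"
proof (induction p rule: mpoly_induct)
  case zero
  show ?case by (simp add: derivationD(4) [OF euler_derivation])
next
  case (add p k c)
  have "Var i * partial i (Poly_Mapping.single k c) =
      Poly_Mapping.single k (of_nat (Poly_Mapping.lookup k i) * c)" for i
  proof (cases "Poly_Mapping.lookup k i = 0")
    case False
    then have "Poly_Mapping.single i 1 + (k - Poly_Mapping.single i 1) = k"
      by (intro poly_mapping_eqI) (auto simp: lookup_add lookup_minus lookup_single when_def)
    then show ?thesis by (simp add: Var_def partial_single mult_single)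
  qed (simp add: partial_single)
  then have "euler (Poly_Mapping.single k c) = Poly_Mapping.single k (of_nat (mdegree k) * c)"
    by (intro poly_mapping_eqI)
      (simp add: euler_def mdegree_def lookup_sum lookup_single sum_distrib_right when_def)
  with add show ?case
    by (simp add: derivationD(1) [OF euler_derivation] lookup_add lookup_single when_def distrib_left)
qed

lemma euler_euler_inv: "euler (euler_inv p) = p - Const (Poly_Mapping.lookup p 0)"
  by (intro poly_mapping_eqI) (simp add: lookup_euler lookup_euler_inv lookup_minus lookup_Const)

context div_const_aut
begin

text \<open>The field is split as \<open>bracket euler D1 + D1 + D0\<close> with \<open>D0\<close>
  of constant components. By induction the two images of \<open>D1\<close> differ by a constant
  combination of the \<open>\<delta> i\<close>. The bracket with \<open>\<phi> euler\<close> negates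
  that combination, so it cancels in the image of \<open>bracket euler D1 + D1\<close>.\<close>

lemma eq_pushforward:
  assumes \<sigma>: "\<sigma> \<in> alg_auts"
    and \<delta>: "\<And>i. pushforward \<sigma> (partial i) = \<delta> i" and h: "pushforward \<sigma> euler = \<phi> euler"
    and D: "D \<in> div_const"
  shows "\<phi> D = pushforward \<sigma> D"
proof -
  note s = alg_autsD [OF \<sigma>]
  have "\<phi> D = pushforward \<sigma> D" if "vf_below N D" for N
    using D that
  proof (induction N arbitrary: D)
    case 0
    then have "D = (\<lambda>p. 0)" using vf_below_0 div_const_derivation by blast
    then show ?case by (simp add: zero pushforward_def comp_def s(4))
  next
    case (Suc N)
    define D1 where "D1 p = (\<Sum>i\<in>UNIV. euler_inv (D (Var i)) * partial i p)" for p
    define D0 where "D0 p = (\<Sum>i\<in>UNIV. Const (Poly_Mapping.lookup (D (Var i)) 0) * partial i p)" for p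
    have D': "D \<in> derivations" by (rule div_const_derivation [OF Suc.prems(1)])
    have D1_Var: "D1 (Var j) = euler_inv (D (Var j))" for j by (simp add: D1_def combination_Var)
    have D0_Var: "D0 (Var j) = Const (Poly_Mapping.lookup (D (Var j)) 0)" for j
      by (simp add: D0_def combination_Var)
    have D1': "D1 \<in> derivations" unfolding D1_def by (rule combination_derivation)
    obtain v where v: "divergence D = Const v" using Suc.prems(1) by (auto simp: div_const_def)
    \<comment> \<open>Each coefficient of the divergence is divided by one more than the degree of
      its monomial, so the constant term is unchanged and the others remain zero.\<close>
    have "divergence D1 = Const v"
    proof (rule poly_mapping_eqI)
      fix m :: "'n \<Rightarrow>\<^sub>0 nat"
      have "Poly_Mapping.lookup (divergence D1) m =
          Poly_Mapping.lookup (divergence D) m / of_nat (mdegree m + 1)"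
        by (simp add: divergence_def D1_Var lookup_sum lookup_partial lookup_euler_inv sum_divide_distrib
            del: of_nat_add of_nat_Suc)
      then show "Poly_Mapping.lookup (divergence D1) m = Poly_Mapping.lookup (Const v) m"
        by (simp add: v lookup_Const)
    qed
    then have D1: "D1 \<in> div_const" by (rule div_constI [OF D1'])
    have D0: "D0 \<in> div_const"
      unfolding D0_def by (rule sum_scaled(1)) (simp_all add: partial_div_const)
    have \<phi>D0: "\<phi> D0 = (\<lambda>p. \<Sum>i\<in>UNIV. Const (Poly_Mapping.lookup (D (Var i)) 0) * \<delta> i p)"
      unfolding D0_def \<delta>_def by (rule sum_scaled(2)) (simp_all add: partial_div_const)
    have below: "vf_below (Suc N) D1"
      using Suc.prems(2) by (auto simp: vf_below_def D1_Var below_def lookup_euler_inv)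
    have split: "D = (\<lambda>p. (bracket euler D1 p + D1 p) + D0 p)"
    proof (rule derivations_eqI [OF D'])
      show "(\<lambda>p. (bracket euler D1 p + D1 p) + D0 p) \<in> derivations"
        by (intro derivations_add derivations_bracket euler_derivation D1' div_const_derivation [OF D0])
      show "D (Var j) = (bracket euler D1 (Var j) + D1 (Var j)) + D0 (Var j)" for j
        by (simp add: bracket_def D1_Var D0_Var euler_euler_inv)
    qed
    have bD1: "bracket euler D1 \<in> div_const" by (rule div_const_bracket [OF euler_div_const D1])
    have "\<phi> D = (\<lambda>p. (bracket (\<phi> euler) (\<phi> D1) p + \<phi> D1 p) + \<phi> D0 p)"
      by (subst split) (simp add: add bD1 D1 D0 div_const_add bracket euler_div_const)
    moreover have "pushforward \<sigma> D = (\<lambda>p. (bracket (\<phi> euler) (pushforward \<sigma> D1) p + pushforward \<sigma> D1 p) + pushforward \<sigma> D0 p)"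
      unfolding h [symmetric] pushforward_bracket [OF \<sigma>, symmetric]
      by (subst split) (simp add: pushforward_def s(1) fun_eq_iff)
    moreover have "pushforward \<sigma> D0 = \<phi> D0"
      by (rule pushforward_eqI [OF \<sigma>])
        (simp add: \<phi>D0 D0_def s(2,3,7) \<delta> [symmetric] pushforward_apply [OF \<sigma>])
    moreover obtain c where c: "\<And>p. \<phi> D1 p - pushforward \<sigma> D1 p = (\<Sum>i\<in>UNIV. Const (c i) * \<delta> i p)"
    proof -
      let ?Z = "\<lambda>p. \<phi> D1 p + Const (- 1) * pushforward \<sigma> D1 p"
      have Z: "?Z \<in> div_const"
        by (rule div_const_add [OF mem [OF D1] div_const_scale [OF pushforward_div_const [OF \<sigma> D1]]])
      have "bracket (\<delta> i) ?Z = (\<lambda>p. 0)" for i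
      proof -
        \<comment> \<open>The bound of \<open>D1\<close> is still \<open>Suc N\<close>, but its
          brackets with the partial derivatives have bound \<open>N\<close>, and these determine
          \<open>\<phi> D1\<close> up to the centralizer of the \<open>\<delta> i\<close>.\<close>
        have "bracket (\<delta> i) (\<phi> D1) = bracket (\<delta> i) (pushforward \<sigma> D1)"
          using Suc.IH [OF div_const_bracket [OF partial_div_const D1, of i]]
            vf_below_bracket_partial [OF D1' below, of i]
          by (simp add: bracket_\<delta> [OF D1] pushforward_bracket [OF \<sigma>] \<delta>)
        then show ?thesis by (simp add: bracket_def fun_eq_iff \<delta>D algebra_simps Const_minus)
      qed
      then obtain c where "\<And>p. ?Z p = (\<Sum>i\<in>UNIV. Const (c i) * \<delta> i p)"
        using \<delta>_centralizer [OF Z] by blast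
      then show thesis by (intro that [of c]) (simp add: Const_minus)
    qed
    moreover have "bracket (\<phi> euler) (\<phi> D1) p - bracket (\<phi> euler) (pushforward \<sigma> D1) p =
        - (\<phi> D1 p - pushforward \<sigma> D1 p)" for p
    proof -
      have e: "\<phi> euler \<in> derivations" by (rule deriv [OF euler_div_const])
      have he: "\<phi> euler (\<delta> i p) = \<delta> i (\<phi> euler p) - \<delta> i p" for i p
        using bracket_\<delta> [OF euler_div_const, of i] unfolding bracket_partial_euler \<delta>_def [symmetric]
        by (simp add: bracket_def fun_eq_iff algebra_simps)
      have "bracket (\<phi> euler) (\<phi> D1) p - bracket (\<phi> euler) (pushforward \<sigma> D1) p =
          \<phi> euler (\<phi> D1 p - pushforward \<sigma> D1 p) - (\<phi> D1 (\<phi> euler p) - pushforward \<sigma> D1 (\<phi> euler p))"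
        by (simp add: bracket_def derivationD(7) [OF e])
      also have "\<dots> = - (\<Sum>i\<in>UNIV. Const (c i) * \<delta> i p)"
        unfolding c by (simp add: derivationD(8,3) [OF e] he right_diff_distrib sum_subtractf)
      finally show ?thesis unfolding c .
    qed
    ultimately show ?case by (simp add: fun_eq_iff algebra_simps)
  qed
  with ex_vf_below show ?thesis by blast
qed

lemma ex_pushforward: "\<exists>\<sigma>\<in>alg_auts. \<forall>D\<in>div_const. \<phi> D = pushforward \<sigma> D"
proof -
  obtain y where y: "\<And>i k. \<delta> i (y k) = (if i = k then 1 else 0)"
    and h: "\<And>p. \<phi> euler p = (\<Sum>k\<in>UNIV. y k * \<delta> k p)" using euler_coordinates by blast
  let ?\<sigma> = "poly_subst y"
  have \<sigma>: "?\<sigma> \<in> alg_auts" by (rule poly_subst_alg_aut [OF y])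
  have d: "\<delta> i (?\<sigma> p) = ?\<sigma> (partial i p)" for i p
    by (rule poly_subst_derivation [of \<delta> y, OF \<delta>_deriv y])
  have "pushforward ?\<sigma> (partial i) = \<delta> i" for i by (rule pushforward_eqI [OF \<sigma>]) (rule d)
  moreover have "pushforward ?\<sigma> euler = \<phi> euler"
    by (rule pushforward_eqI [OF \<sigma>]) (simp add: h d euler_def alg_autsD(2,7) [OF \<sigma>])
  ultimately show ?thesis using eq_pushforward [OF \<sigma>] \<sigma> by blast
qed

end

section \<open>The homomorphism into the group of Lie algebra automorphisms\<close>

lemma conjugation_eq: "conjugation \<sigma> = (\<lambda>D\<in>div_const. pushforward \<sigma> D)"
  by (simp add: conjugation_def pushforward_def)

lemma conjugation_lie_auts:
  assumes \<sigma>: "\<sigma> \<in> alg_auts"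
  shows "conjugation \<sigma> \<in> lie_auts div_const"
proof (rule lie_autsI)
  have "bij_betw (pushforward \<sigma>) div_const div_const"
    by (rule bij_betw_byWitness [where f' = "pushforward (inv_into UNIV \<sigma>)"])
      (auto simp: pushforward_inv [OF \<sigma>] pushforward_div_const \<sigma> inv_alg_auts)
  then show "conjugation \<sigma> \<in> Bij div_const"
    unfolding conjugation_eq Bij_def by (simp add: bij_betw_cong [of div_const "restrict _ div_const"])
next
  fix D E :: "('a, 'b) mpoly \<Rightarrow> ('a, 'b) mpoly" and c
  assume D: "D \<in> div_const"
  show "conjugation \<sigma> (\<lambda>p. Const c * D p) = (\<lambda>p. Const c * conjugation \<sigma> D p)"
    unfolding conjugation_eq restrict_apply' [OF D] restrict_apply' [OF div_const_scale [OF D]]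
    by (simp add: pushforward_def fun_eq_iff alg_autsD(2,3) [OF \<sigma>])
  assume E: "E \<in> div_const"
  show "conjugation \<sigma> (\<lambda>p. D p + E p) = (\<lambda>p. conjugation \<sigma> D p + conjugation \<sigma> E p)"
    unfolding conjugation_eq restrict_apply' [OF D] restrict_apply' [OF E] restrict_apply' [OF div_const_add [OF D E]]
    by (simp add: pushforward_def fun_eq_iff alg_autsD(1) [OF \<sigma>])
  show "conjugation \<sigma> (bracket D E) = bracket (conjugation \<sigma> D) (conjugation \<sigma> E)"
    unfolding conjugation_eq restrict_apply' [OF D] restrict_apply' [OF E] restrict_apply' [OF div_const_bracket [OF D E]]
    by (rule pushforward_bracket [OF \<sigma>])
qed

lemma pushforward_comp:
  assumes "\<sigma> \<in> alg_auts" "\<tau> \<in> alg_auts"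
  shows "pushforward (\<sigma> \<circ> \<tau>) D = pushforward \<sigma> (pushforward \<tau> D)"
  unfolding pushforward_def o_inv_distrib [OF alg_autsD(10) [OF assms(1)] alg_autsD(10) [OF assms(2)]]
  by (simp add: o_assoc)

text \<open>The automorphism \<open>?\<rho>\<close> commutes with every field of the Lie algebra.
  Commuting with the partial derivatives makes it a translation of the variables, and commuting with
  \<open>Var j * partial j\<close> excludes a nonzero shift.\<close>

lemma pushforward_inject:
  fixes \<sigma> \<tau> :: "('n::finite, 'k::field_char_0) mpoly \<Rightarrow> ('n, 'k) mpoly"
  assumes \<sigma>: "\<sigma> \<in> alg_auts" and \<tau>: "\<tau> \<in> alg_auts"
    and eq: "\<And>D. D \<in> div_const \<Longrightarrow> pushforward \<sigma> D = pushforward \<tau> D"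
  shows "\<sigma> = \<tau>"
proof -
  let ?\<rho> = "\<lambda>p. inv_into UNIV \<tau> (\<sigma> p)"
  note s = alg_autsD [OF \<sigma>] and i = alg_autsD [OF inv_alg_auts [OF \<tau>]] and t = alg_autsD [OF \<tau>]
  have \<rho>: "?\<rho> (D p) = D (?\<rho> p)" if "D \<in> div_const" for D p
  proof -
    have "\<sigma> (D p) = \<tau> (D (?\<rho> p))"
      using fun_cong [OF eq [OF that], of "\<sigma> p"]
      by (simp add: pushforward_apply [OF \<sigma>]) (simp add: pushforward_def)
    then show ?thesis by (simp add: t(8))
  qed
  have Var: "?\<rho> (Var j) = Var j" for j
  proof -
    have "partial k (?\<rho> (Var j) - Var j) = 0" for k
      using \<rho> [OF partial_div_const, of k "Var j"]
      by (simp add: partial_diff partial_Var s(4,5) i(4,5) split: if_splits)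
    then obtain c where c: "?\<rho> (Var j) - Var j = Const c" by (metis Const_of_partials_zero)
    have "?\<rho> (Var j) = Var j * partial j (?\<rho> (Var j))"
      using \<rho> [OF Var_partial_div_const, of j j "Var j"] by (simp add: partial_Var)
    also have "?\<rho> (Var j) = Var j + Const c" using c by (simp add: algebra_simps)
    finally have "c = 0" by (simp add: partial_add partial_Var)
    with c show ?thesis by simp
  qed
  have "?\<rho> p = p" for p
    by (induction p rule: mpoly_ring_induct) (simp_all add: s i Var)
  then have "\<sigma> p = \<tau> p" for p using t(9) [of "\<sigma> p"] by simp
  then show ?thesis by blast
qed

theorem theorem1p2:
  shows "(conjugation :: (('n::finite, 'k::field_char_0) mpoly \<Rightarrow> ('n, 'k) mpoly) \<Rightarrow> _)
    \<in> iso alg_aut_group (lie_aut_group div_const)"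
proof -
  let ?G = "alg_aut_group :: (('n, 'k) mpoly \<Rightarrow> ('n, 'k) mpoly) monoid"
  let ?H = "lie_aut_group div_const :: ((('n, 'k) mpoly \<Rightarrow> ('n, 'k) mpoly) \<Rightarrow> _) monoid"
  have G: "carrier ?G = alg_auts" and H: "carrier ?H = lie_auts div_const"
    by (simp_all add: alg_aut_group_def lie_aut_group_def)
  have "conjugation \<in> hom ?G ?H"
  proof (rule homI)
    fix \<sigma> \<tau> assume "\<sigma> \<in> carrier ?G" "\<tau> \<in> carrier ?G"
    then have \<sigma>: "\<sigma> \<in> alg_auts" and \<tau>: "\<tau> \<in> alg_auts" by (simp_all add: G)
    have "\<sigma> \<otimes>\<^bsub>?G\<^esub> \<tau> = \<sigma> \<circ> \<tau>"
      using alg_autsD(10) [OF \<sigma>] alg_autsD(10) [OF \<tau>]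
      by (simp add: alg_aut_group_def BijGroup_def Bij_def compose_def comp_def restrict_def)
    moreover have "conjugation \<sigma> \<otimes>\<^bsub>?H\<^esub> conjugation \<tau> = compose div_const (conjugation \<sigma>) (conjugation \<tau>)"
      using lie_autsD(1) [OF conjugation_lie_auts [OF \<sigma>]] lie_autsD(1) [OF conjugation_lie_auts [OF \<tau>]]
      by (simp add: lie_aut_group_def BijGroup_def)
    moreover have "conjugation (\<sigma> \<circ> \<tau>) = compose div_const (conjugation \<sigma>) (conjugation \<tau>)"
      by (auto simp: conjugation_eq compose_def fun_eq_iff pushforward_comp [OF \<sigma> \<tau>] pushforward_div_const [OF \<tau>])
    ultimately show "conjugation (\<sigma> \<otimes>\<^bsub>?G\<^esub> \<tau>) = conjugation \<sigma> \<otimes>\<^bsub>?H\<^esub> conjugation \<tau>" by simp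
  qed (simp add: G H conjugation_lie_auts)
  moreover have "inj_on conjugation (carrier ?G)"
  proof (rule inj_onI)
    fix \<sigma> \<tau> assume "\<sigma> \<in> carrier ?G" "\<tau> \<in> carrier ?G" and eq: "conjugation \<sigma> = conjugation \<tau>"
    then have \<sigma>: "\<sigma> \<in> alg_auts" and \<tau>: "\<tau> \<in> alg_auts" by (simp_all add: G)
    show "\<sigma> = \<tau>"
    proof (rule pushforward_inject [OF \<sigma> \<tau>])
      fix D :: "('n, 'k) mpoly \<Rightarrow> ('n, 'k) mpoly" assume D: "D \<in> div_const"
      show "pushforward \<sigma> D = pushforward \<tau> D"
        using fun_cong [OF eq, of D] unfolding conjugation_eq restrict_apply' [OF D] .
    qed
  qed
  moreover have "\<phi> \<in> conjugation ` carrier ?G" if \<phi>: "\<phi> \<in> carrier ?H" for \<phi>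
  proof -
    have \<phi>: "\<phi> \<in> lie_auts div_const" using \<phi> by (simp add: H)
    then interpret div_const_aut \<phi> by unfold_locales
    obtain \<sigma> where \<sigma>: "\<sigma> \<in> alg_auts" "\<forall>D\<in>div_const. \<phi> D = pushforward \<sigma> D"
      using ex_pushforward by blast
    \<comment> \<open>Both maps are extensional outside \<open>div_const\<close>, so agreement on
      its members gives equality.\<close>
    have "\<phi> = conjugation \<sigma>"
      by (rule extensionalityI [of _ div_const])
        (use lie_autsD(1) [OF \<phi>] \<sigma> in \<open>auto simp: Bij_def conjugation_eq\<close>)
    with \<sigma> show ?thesis unfolding G by blast
  qed
  moreover have "conjugation ` carrier ?G \<subseteq> carrier ?H"
    using conjugation_lie_auts by (auto simp: G H)
  ultimately show ?thesis unfolding iso_def bij_betw_def by blast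
qed

end
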